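(* Let $k\ge 2$, $p\ge 0$, $m\ge 0$ be integers, and let $G$ be a simple graph that is $k$-weakly $(4kp-2p+2m)$-connected, i.e. for any two disjoint vertex sets $A,B$ with $A\neq\emptyset$ and $A\cup B\subsetneq V(G)$, $d_{G-B}(A)\ge 4kp-2p+2m-k|B|$. Then $G$ has a spanning subgraph $H$ containing a packing (pairwise edge-disjoint collection) of $m$ spanning trees and $p$ spanning $k$-rigid subgraphs such that for each vertex $v$, $$d_H(v)\le\left\lceil\frac{d_G(v)}{2}\right\rceil+kp+m.$$
   Context: Graphs are finite and loopless. $d_{G-B}(A)$ is the number of edges of $G-B$ with exactly one end in $A$; $e_F(X)$ the number of edges of $F$ with both ends in $X$. A graph $H$ is $k$-rigid if it has a spanning subgraph $F$ with $e_F(X)\le k|X|-(2k-1)$ for every $X\subseteq V(H)$ with $|X|\ge 2$ and $|E(F)|=k|V(H)|-(2k-1)$ (i.e. $\ell_{k,2k-1}$-rigid, where $\ell_{k,2k-1}$ is $k$ on singletons and $2k-1$ on sets of at least two vertices). *)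

theory Defs
  imports Complex_Main
begin

text \<open>
  A graph is given by its vertex set \<open>V\<close> and its edge set \<open>E\<close>, whose members are the two-element sets of
  end vertices; this excludes loops and parallel edges. As usual, the vertex set of a graph is
  nonempty. Spanning subgraphs of \<open>(V, E)\<close> are the graphs \<open>(V, F)\<close> with \<open>F \<subseteq> E\<close>.
\<close>

definition simple_graph :: "'a set \<Rightarrow> 'a set set \<Rightarrow> bool" where
  "simple_graph V E \<longleftrightarrow> finite V \<and> V \<noteq> {} \<and> (\<forall>e\<in>E. e \<subseteq> V \<and> card e = 2)"

definition degree :: "'a set set \<Rightarrow> 'a \<Rightarrow> nat" where
  "degree E v = card {e \<in> E. v \<in> e}"

definition delete_vertices :: "'a set set \<Rightarrow> 'a set \<Rightarrow> 'a set set" where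
  "delete_vertices E B = {e \<in> E. e \<inter> B = {}}"

definition cut_degree :: "'a set set \<Rightarrow> 'a set \<Rightarrow> nat" where
  "cut_degree E A = card {e \<in> E. card (e \<inter> A) = 1}"

definition induced_edge_count :: "'a set set \<Rightarrow> 'a set \<Rightarrow> nat" where
  "induced_edge_count F X = card {e \<in> F. e \<subseteq> X}"

definition weakly_connected :: "nat \<Rightarrow> int \<Rightarrow> 'a set \<Rightarrow> 'a set set \<Rightarrow> bool" where
  "weakly_connected k r V E \<longleftrightarrow>
     (\<forall>A B. A \<inter> B = {} \<and> A \<noteq> {} \<and> A \<union> B \<subset> V \<longrightarrow>
        int (cut_degree (delete_vertices E B) A) \<ge> r - int k * int (card B))"

definition connected_graph :: "'a set \<Rightarrow> 'a set set \<Rightarrow> bool" where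
  "connected_graph V E \<longleftrightarrow> (\<forall>u\<in>V. \<forall>v\<in>V. (u, v) \<in> {(x, y). {x, y} \<in> E}\<^sup>*)"

definition is_cycle :: "'a set set \<Rightarrow> 'a list \<Rightarrow> bool" where
  "is_cycle E c \<longleftrightarrow> length c \<ge> 3 \<and> distinct c \<and>
     (\<forall>i<length c. {c ! i, c ! (Suc i mod length c)} \<in> E)"

definition is_tree :: "'a set \<Rightarrow> 'a set set \<Rightarrow> bool" where
  "is_tree V T \<longleftrightarrow> simple_graph V T \<and> connected_graph V T \<and> (\<nexists>c. is_cycle T c)"

text \<open>
  The function \<open>\<ell>\<close> with parameters \<open>k\<close> and \<open>2k - 1\<close>, used on nonempty sets only. Its value \<open>k\<close> on
  singletons makes the one-vertex graph \<open>k\<close>-rigid.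
\<close>

definition ell :: "nat \<Rightarrow> 'a set \<Rightarrow> int" where
  "ell k X = (if card X = 1 then int k else 2 * int k - 1)"

definition k_rigid :: "nat \<Rightarrow> 'a set \<Rightarrow> 'a set set \<Rightarrow> bool" where
  "k_rigid k V E \<longleftrightarrow> simple_graph V E \<and>
     (\<exists>F\<subseteq>E.
        (\<forall>X\<subseteq>V. X \<noteq> {} \<longrightarrow> int (induced_edge_count F X) \<le> int k * int (card X) - ell k X) \<and>
        int (card F) = int k * int (card V) - ell k V)"

text \<open>
  A packing is an indexed family, so that empty edge sets (on a one-vertex graph) may be repeated.
\<close>

definition contains_packing :: "nat \<Rightarrow> nat \<Rightarrow> nat \<Rightarrow> 'a set \<Rightarrow> 'a set set \<Rightarrow> bool" where
  "contains_packing m p k V H \<longleftrightarrow>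
     (\<exists>T R. (\<forall>i<m. T i \<subseteq> H \<and> is_tree V (T i)) \<and>
            (\<forall>j<p. R j \<subseteq> H \<and> k_rigid k V (R j)) \<and>
            (\<forall>i<m. \<forall>i'<m. i \<noteq> i' \<longrightarrow> T i \<inter> T i' = {}) \<and>
            (\<forall>j<p. \<forall>j'<p. j \<noteq> j' \<longrightarrow> R j \<inter> R j' = {}) \<and>
            (\<forall>i<m. \<forall>j<p. T i \<inter> R j = {}))"

end

theory Submission
  imports Defs "HOL-Library.Disjoint_Sets"
begin

text \<open>
  Instead of bounding the degrees of \<open>H\<close> from above, one bounds the degrees of the set \<open>K\<close> of discarded
  edges from below: \<open>K\<close> has to contain at least \<open>g v = d v div 2 - (k * p + m)\<close> edges at every vertex \<open>v\<close>.
  This holds if \<open>K\<close> has \<open>\<Sum>v\<in>V. g v\<close> edges and every \<open>J \<subseteq> K\<close> has at most \<open>\<Sum>v\<in>\<Union>J. g v\<close> edges,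
  which is a matroid condition. So the edge set has to contain disjoint bases of \<open>m\<close> graphic matroids,
  of \<open>p\<close> count matroids with parameters \<open>(k, 2k - 1)\<close>, and of this last matroid. By the theorem of Rado
  and Edmonds this amounts to a rank inequality for every edge set \<open>Z\<close>. The ranks of \<open>Z\<close> are given by
  the components and the rigid blocks of \<open>Z\<close>; every edge outside \<open>Z\<close> is split into two halves, one for
  each of its ends, and weak connectivity, applied to the blocks and components, provides
  enough halves.
\<close>

section \<open>Rado's theorem\<close>

text \<open>
  Rado's theorem on independent transversals, in the form of a list colouring: as long as some element
  has two admissible colours, submodularity shows that one of them can be given up.
\<close>

lemma rado_colouring:
  fixes r :: "'c \<Rightarrow> 'e set \<Rightarrow> nat"
  assumes E: "finite E" and C: "finite C"
    and mono: "\<And>c J J'. c \<in> C \<Longrightarrow> J \<subseteq> J' \<Longrightarrow> J' \<subseteq> E \<Longrightarrow> r c J \<le> r c J'"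
    and submod: "\<And>c J J'. c \<in> C \<Longrightarrow> J \<subseteq> E \<Longrightarrow> J' \<subseteq> E \<Longrightarrow>
                   r c (J \<union> J') + r c (J \<inter> J') \<le> r c J + r c J'"
    and empty: "\<And>c. c \<in> C \<Longrightarrow> r c {} = 0"
    and cond: "\<And>J. J \<subseteq> E \<Longrightarrow> card J \<le> (\<Sum>c\<in>C. r c J)"
  shows "\<exists>col. (\<forall>e\<in>E. col e \<in> C) \<and> (\<forall>c\<in>C. \<forall>J\<subseteq>{e\<in>E. col e = c}. card J \<le> r c J)"
proof -
  \<comment> \<open>\<open>A e\<close> is the list of colours still allowed at \<open>e\<close>, and
    \<open>ok\<close> is Rado's condition for these lists. The induction is on their total size;
    lists with one colour each are the colouring.\<close>
  define ok where
    "ok A \<longleftrightarrow> (\<forall>J\<subseteq>E. card J \<le> (\<Sum>c\<in>C. r c {e\<in>J. c \<in> A e}))" for A :: "'e \<Rightarrow> 'c set"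
  have main: "\<exists>col. (\<forall>e\<in>E. col e \<in> C) \<and> (\<forall>c\<in>C. \<forall>J\<subseteq>{e\<in>E. col e = c}. card J \<le> r c J)"
    if "ok A" "\<And>e. e \<in> E \<Longrightarrow> A e \<subseteq> C" for A
    using that
  proof (induction "\<Sum>e\<in>E. card (A e)" arbitrary: A rule: less_induct)
    case less
    note okA = less.prems(1) and AC = less.prems(2)
    have okD: "card J \<le> (\<Sum>c\<in>C. r c {e\<in>J. c \<in> A e})" if "J \<subseteq> E" for J
      using okA that unfolding ok_def by blast
    have fA: "finite (A e)" if "e \<in> E" for e
      using AC[OF that] C finite_subset by blast
    have ne: "A e \<noteq> {}" if "e \<in> E" for e
    proof
      assume "A e = {}"
      then have *: "{x\<in>{e}. c \<in> A x} = {}" for c by auto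
      have "card {e} \<le> (\<Sum>c\<in>C. r c {x\<in>{e}. c \<in> A x})"
        using that by (intro okD) simp
      then show False unfolding * using empty by simp
    qed
    show ?case
    proof (cases "\<exists>e\<in>E. \<exists>i j. i \<in> A e \<and> j \<in> A e \<and> i \<noteq> j")
      case False
      define col where "col e = (SOME c. c \<in> A e)" for e
      have col: "A e = {col e}" if "e \<in> E" for e
      proof -
        have "col e \<in> A e" unfolding col_def using ne[OF that] by (simp add: some_in_eq)
        with False that show ?thesis by blast
      qed
      have "card J \<le> r c J" if c: "c \<in> C" and J: "J \<subseteq> {e\<in>E. col e = c}" for c J
      proof -
        have JE: "J \<subseteq> E" using J by auto
        have *: "{e\<in>J. c' \<in> A e} = (if c' = c then J else {})" for c'
          using J JE col by auto
        have "card J \<le> (\<Sum>c'\<in>C. r c' {e\<in>J. c' \<in> A e})"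
          by (rule okD[OF JE])
        also have "\<dots> = (\<Sum>c'\<in>C. if c' = c then r c J else 0)"
          by (intro sum.cong) (auto simp: * empty)
        also have "\<dots> = r c J" using c C by simp
        finally show ?thesis .
      qed
      moreover have "\<forall>e\<in>E. col e \<in> C" using col AC by blast
      ultimately show ?thesis by blast
    next
      case True
      then obtain e i j where e: "e \<in> E" and i: "i \<in> A e" and j: "j \<in> A e" and ij: "i \<noteq> j"
        by blast
      have smaller: "(\<Sum>x\<in>E. card ((A(e := A e - {l})) x)) < (\<Sum>x\<in>E. card (A x))"
        if "l \<in> A e" for l
      proof (rule sum_strict_mono_ex1[OF E])
        show "\<forall>x\<in>E. card ((A(e := A e - {l})) x) \<le> card (A x)"
          using fA by (auto intro!: card_mono)
        show "\<exists>x\<in>E. card ((A(e := A e - {l})) x) < card (A x)"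
          using e that fA[OF e] by (intro bexI[of _ e]) (auto intro!: psubset_card_mono simp del: card_Diff_singleton card_Diff_insert)
      qed
      have "ok (A(e := A e - {i})) \<or> ok (A(e := A e - {j}))"
      proof (rule ccontr)
        assume "\<not> ?thesis"
        then obtain J1 J2 where J1: "J1 \<subseteq> E" and J2: "J2 \<subseteq> E"
          and v1: "(\<Sum>c\<in>C. r c {x\<in>J1. c \<in> (A(e := A e - {i})) x}) < card J1"
          and v2: "(\<Sum>c\<in>C. r c {x\<in>J2. c \<in> (A(e := A e - {j})) x}) < card J2"
          unfolding ok_def by (meson not_le)
        have e1: "e \<in> J1"
        proof (rule ccontr)
          assume "e \<notin> J1"
          then have "{x\<in>J1. c \<in> (A(e := A e - {i})) x} = {x\<in>J1. c \<in> A x}" for c by auto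
          with v1 have "(\<Sum>c\<in>C. r c {x\<in>J1. c \<in> A x}) < card J1" by simp
          with okD[OF J1] show False by simp
        qed
        have e2: "e \<in> J2"
        proof (rule ccontr)
          assume "e \<notin> J2"
          then have "{x\<in>J2. c \<in> (A(e := A e - {j})) x} = {x\<in>J2. c \<in> A x}" for c by auto
          with v2 have "(\<Sum>c\<in>C. r c {x\<in>J2. c \<in> A x}) < card J2" by simp
          with okD[OF J2] show False by simp
        qed
        \<comment> \<open>In \<open>?X\<close> the colour \<open>i\<close> is barred at
          \<open>e\<close>, in \<open>?Y\<close> the colour \<open>j\<close>. As
          \<open>i \<noteq> j\<close>, every colour allowed at \<open>e\<close> survives in one of
          them, so the union carries the full lists on \<open>J1 \<union> J2\<close>. The
          intersection is controlled only away from \<open>e\<close>, which costs 1, whereas the two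
          strict violations gain 2.\<close>
        let ?I = "(J1 \<inter> J2) - {e}"
        have le: "r c {x\<in>J1 \<union> J2. c \<in> A x} + r c {x\<in>?I. c \<in> A x}
           \<le> r c {x\<in>J1. c \<in> (A(e := A e - {i})) x} + r c {x\<in>J2. c \<in> (A(e := A e - {j})) x}"
          (is "?l \<le> r c ?X + r c ?Y") if c: "c \<in> C" for c
        proof -
          have XY: "?X \<union> ?Y = {x\<in>J1 \<union> J2. c \<in> A x}" using e1 e2 ij by auto
          have sub: "{x\<in>?I. c \<in> A x} \<subseteq> ?X \<inter> ?Y" by auto
          have "r c {x\<in>?I. c \<in> A x} \<le> r c (?X \<inter> ?Y)"
            by (rule mono[OF c sub]) (use J1 in auto)
          moreover have "r c (?X \<union> ?Y) + r c (?X \<inter> ?Y) \<le> r c ?X + r c ?Y"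
            by (rule submod[OF c]) (use J1 J2 in auto)
          ultimately show ?thesis unfolding XY by linarith
        qed
        have f1: "finite J1" and f2: "finite J2" using J1 J2 E finite_subset by auto
        have "card (J1 \<union> J2) + card ?I
            \<le> (\<Sum>c\<in>C. r c {x\<in>J1 \<union> J2. c \<in> A x}) + (\<Sum>c\<in>C. r c {x\<in>?I. c \<in> A x})"
        proof (rule add_mono)
          show "card (J1 \<union> J2) \<le> (\<Sum>c\<in>C. r c {x\<in>J1 \<union> J2. c \<in> A x})"
            by (rule okD) (use J1 J2 in auto)
          show "card ?I \<le> (\<Sum>c\<in>C. r c {x\<in>?I. c \<in> A x})"
            by (rule okD) (use J1 J2 in auto)
        qed
        also have "\<dots> \<le> (\<Sum>c\<in>C. r c {x\<in>J1. c \<in> (A(e := A e - {i})) x}) +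
                        (\<Sum>c\<in>C. r c {x\<in>J2. c \<in> (A(e := A e - {j})) x})"
          unfolding sum.distrib[symmetric] by (intro sum_mono le)
        finally have "card (J1 \<union> J2) + card ?I + 2 \<le> card J1 + card J2" using v1 v2 by linarith
        moreover have "card (J1 \<union> J2) + card (J1 \<inter> J2) = card J1 + card J2"
          using card_Un_Int[OF f1 f2] by simp
        moreover have "card (J1 \<inter> J2) = Suc (card ?I)"
          using e1 e2 f1 by (intro card.remove) auto
        ultimately show False by linarith
      qed
      then obtain l where l: "l \<in> A e" "ok (A(e := A e - {l}))" using i j by blast
      show ?thesis
        by (rule less.hyps[OF smaller[OF l(1)] l(2)]) (use AC in auto)
    qed
  qed
  have "ok (\<lambda>_. C)" unfolding ok_def
  proof (intro allI impI)
    fix J assume "J \<subseteq> E"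
    then have "card J \<le> (\<Sum>c\<in>C. r c J)" by (rule cond)
    also have "\<dots> = (\<Sum>c\<in>C. r c {e\<in>J. c \<in> C})" by (intro sum.cong) auto
    finally show "card J \<le> (\<Sum>c\<in>C. r c {e\<in>J. c \<in> C})" .
  qed
  then show ?thesis by (rule main) auto
qed

section \<open>Count matroids\<close>

text \<open>
  For \<open>\<kappa> = 1\<close> these are forests. The bounds are written without subtraction; they say
  \<open>card J \<le> \<kappa> * card (\<Union>J) - (2 * \<kappa> - 1)\<close>.
\<close>

definition sparse :: "nat \<Rightarrow> 'a set set \<Rightarrow> bool" where
  "sparse \<kappa> I \<longleftrightarrow> (\<forall>J\<subseteq>I. J \<noteq> {} \<longrightarrow> card J + 2 * \<kappa> \<le> \<kappa> * card (\<Union>J) + 1)"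

text \<open>A sparse tight set is the edge set of a tree on \<open>\<Union>J\<close> if
  \<open>\<kappa> = 1\<close>, and of a minimally k-rigid graph there if
  \<open>\<kappa> = k\<close>. A single edge is tight for every \<open>\<kappa>\<close>.\<close>

definition tight :: "nat \<Rightarrow> 'a set set \<Rightarrow> bool" where
  "tight \<kappa> J \<longleftrightarrow> J \<noteq> {} \<and> card J + 2 * \<kappa> = \<kappa> * card (\<Union>J) + 1"

definition sparse_rank :: "nat \<Rightarrow> 'a set set \<Rightarrow> nat" where
  "sparse_rank \<kappa> Z = Max (card ` {I. I \<subseteq> Z \<and> sparse \<kappa> I})"

lemma sparse_subset: "sparse \<kappa> I \<Longrightarrow> J \<subseteq> I \<Longrightarrow> sparse \<kappa> J"
  unfolding sparse_def by blast

lemma sparse_empty: "sparse \<kappa> {}"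
  unfolding sparse_def by blast

lemma sparseD: "sparse \<kappa> I \<Longrightarrow> J \<subseteq> I \<Longrightarrow> J \<noteq> {} \<Longrightarrow> card J + 2 * \<kappa> \<le> \<kappa> * card (\<Union>J) + 1"
  unfolding sparse_def by blast

section \<open>Tight sets, blocks and maximal sparse sets\<close>

locale pair_family =
  fixes E :: "'a set set"
  assumes finite_E: "finite E" and card2: "e \<in> E \<Longrightarrow> card e = 2"
begin

lemma finite_edges: "J \<subseteq> E \<Longrightarrow> finite J"
  using finite_E finite_subset by blast

lemma finite_Union_edges: "J \<subseteq> E \<Longrightarrow> finite (\<Union>J)"
proof (rule finite_Union)
  fix e assume "J \<subseteq> E" "e \<in> J"
  then have "card e = 2" using card2 by blast
  then show "finite e" by (simp add: card_ge_0_finite)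
qed (rule finite_edges)

text \<open>Uncrossing: \<open>card J\<close> is modular and \<open>card (\<Union>J)\<close> is
  submodular, so the sparsity bounds of the union and of the nonempty intersection leave no room and
  both are attained.\<close>

lemma tight_Un:
  assumes "I \<subseteq> E" "sparse \<kappa> I" "S \<subseteq> I" "T \<subseteq> I" "tight \<kappa> S" "tight \<kappa> T" "S \<inter> T \<noteq> {}"
  shows "tight \<kappa> (S \<union> T)"
proof -
  have SE: "S \<subseteq> E" and TE: "T \<subseteq> E" using assms by auto
  have 1: "card (S \<union> T) + card (S \<inter> T) = card S + card T"
    using card_Un_Int[OF finite_edges[OF SE] finite_edges[OF TE]] by simp
  have "card (\<Union>S \<union> \<Union>T) + card (\<Union>S \<inter> \<Union>T) = card (\<Union>S) + card (\<Union>T)"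
    using card_Un_Int[OF finite_Union_edges[OF SE] finite_Union_edges[OF TE]] by simp
  moreover have "card (\<Union>(S \<inter> T)) \<le> card (\<Union>S \<inter> \<Union>T)"
    using finite_Union_edges[OF SE] by (intro card_mono) auto
  ultimately have "card (\<Union>(S \<union> T)) + card (\<Union>(S \<inter> T)) \<le> card (\<Union>S) + card (\<Union>T)"
    by (simp add: Union_Un_distrib)
  then have 2: "\<kappa> * card (\<Union>(S \<union> T)) + \<kappa> * card (\<Union>(S \<inter> T)) \<le> \<kappa> * card (\<Union>S) + \<kappa> * card (\<Union>T)"
    unfolding add_mult_distrib2[symmetric] by (rule mult_le_mono2)
  have 3: "card (S \<inter> T) + 2 * \<kappa> \<le> \<kappa> * card (\<Union>(S \<inter> T)) + 1"
    by (rule sparseD[OF assms(2)]) (use assms in auto)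
  have 4: "card (S \<union> T) + 2 * \<kappa> \<le> \<kappa> * card (\<Union>(S \<union> T)) + 1"
    by (rule sparseD[OF assms(2)]) (use assms in \<open>auto simp: tight_def\<close>)
  show ?thesis using 1 2 3 4 assms(5,6) unfolding tight_def by auto
qed

lemma tight_singleton: "e \<in> E \<Longrightarrow> tight \<kappa> {e}"
  using card2 by (simp add: tight_def)

text \<open>The blocks are the inclusion-maximal tight subsets of \<open>I\<close>. Uncrossing makes
  them disjoint, and the maximality of \<open>I\<close> makes them span every edge of
  \<open>Z\<close>.\<close>

lemma maximal_sparse_blocks:
  assumes \<kappa>: "\<kappa> \<ge> 1" and Z: "Z \<subseteq> E" and I: "I \<subseteq> Z" "sparse \<kappa> I"
    and max: "\<And>e. e \<in> Z - I \<Longrightarrow> \<not> sparse \<kappa> (insert e I)"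
  obtains \<T> where "\<Union>\<T> = I" "disjoint \<T>" "\<And>T. T \<in> \<T> \<Longrightarrow> tight \<kappa> T"
    "\<And>e. e \<in> Z \<Longrightarrow> \<exists>T\<in>\<T>. e \<subseteq> \<Union>T"
    "\<And>T T'. T \<in> \<T> \<Longrightarrow> T' \<in> \<T> \<Longrightarrow> T \<noteq> T' \<Longrightarrow> \<not> tight \<kappa> (T \<union> T')"
proof -
  have IE: "I \<subseteq> E" using I Z by auto
  define \<T> where "\<T> = {T. T \<subseteq> I \<and> tight \<kappa> T \<and> (\<forall>T'. T' \<subseteq> I \<and> tight \<kappa> T' \<longrightarrow> T \<subseteq> T' \<longrightarrow> T = T')}"
  have ex: "\<exists>T\<in>\<T>. S \<subseteq> T" if "S \<subseteq> I" "tight \<kappa> S" for S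
  proof -
    let ?A = "{T. T \<subseteq> I \<and> tight \<kappa> T}"
    have "finite ?A" using finite_edges[OF IE] by (auto intro: finite_subset[of _ "Pow I"])
    moreover have "S \<in> ?A" using that by simp
    ultimately have "\<exists>T\<in>?A. S \<subseteq> T \<and> (\<forall>T'\<in>?A. T \<subseteq> T' \<longrightarrow> T = T')"
      by (rule finite_has_maximal2)
    then obtain T where "T \<in> ?A" "S \<subseteq> T" "\<forall>T'\<in>?A. T \<subseteq> T' \<longrightarrow> T = T'" by auto
    then show ?thesis by (intro bexI[of _ T]) (auto simp: \<T>_def)
  qed
  have nm: "\<not> tight \<kappa> (T \<union> T')" if "T \<in> \<T>" "T' \<in> \<T>" "T \<noteq> T'" for T T'
  proof
    assume t: "tight \<kappa> (T \<union> T')"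
    have sub: "T \<union> T' \<subseteq> I" using that unfolding \<T>_def by auto
    have "T \<union> T' = T" using that(1) t sub unfolding \<T>_def by blast
    moreover have "T \<union> T' = T'" using that(2) t sub unfolding \<T>_def by blast
    ultimately show False using that(3) by simp
  qed
  show ?thesis
  proof
    show "\<Union>\<T> = I"
    proof
      show "\<Union>\<T> \<subseteq> I" unfolding \<T>_def by auto
      show "I \<subseteq> \<Union>\<T>"
      proof
        fix e assume "e \<in> I"
        then have "\<exists>T\<in>\<T>. {e} \<subseteq> T" using IE by (intro ex tight_singleton) auto
        then show "e \<in> \<Union>\<T>" by auto
      qed
    qed
    show "disjoint \<T>"
    proof (unfold disjoint_def, intro ballI impI, rule ccontr)
      fix T T' assume T: "T \<in> \<T>" "T' \<in> \<T>" "T \<noteq> T'" "T \<inter> T' \<noteq> {}"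
      then have "tight \<kappa> (T \<union> T')" 
        by (intro tight_Un[OF IE I(2)]) (auto simp: \<T>_def)
      with nm[OF T(1-3)] show False ..
    qed
    show "tight \<kappa> T" if "T \<in> \<T>" for T using that unfolding \<T>_def by auto
    show "\<exists>T\<in>\<T>. e \<subseteq> \<Union>T" if e: "e \<in> Z" for e
    proof (cases "e \<in> I")
      case True
      then have "\<exists>T\<in>\<T>. {e} \<subseteq> T" using IE by (intro ex tight_singleton) auto
      then show ?thesis by auto
    next
      case False
      then obtain L where L: "L \<subseteq> insert e I" "L \<noteq> {}" "\<kappa> * card (\<Union>L) + 1 < card L + 2 * \<kappa>"
        using max[of e] e unfolding sparse_def by (auto simp: not_le)
      \<comment> \<open>Sparsity fails at some \<open>L\<close> through \<open>e\<close>. Removing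
        \<open>e\<close> lowers the count by only 1, so the bound for \<open>J\<close> is attained
        and \<open>e\<close> adds no new vertex to it.\<close>
      define J where "J = L - {e}"
      have JI: "J \<subseteq> I" using L unfolding J_def by auto
      have "e \<in> L"
      proof (rule ccontr)
        assume "e \<notin> L"
        then have "L \<subseteq> I" using L by auto
        with sparseD[OF I(2) this L(2)] L(3) show False by simp
      qed
      then have LJ: "L = insert e J" unfolding J_def by auto
      have fJ: "finite J" using JI IE finite_edges by auto
      have eJ: "e \<notin> J" unfolding J_def by simp
      have ce: "card e = 2" using e Z card2 by auto
      have "J \<noteq> {}" using L(3) ce unfolding LJ by auto
      note sp = sparseD[OF I(2) JI this]
      have fU: "finite (\<Union>L)" using L e Z IE by (intro finite_Union_edges) auto
      have le: "card (\<Union>J) \<le> card (\<Union>L)" using fU unfolding LJ by (intro card_mono) auto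
      have cL: "card L = card J + 1" using fJ eJ unfolding LJ by simp
      have k1: "\<kappa> * card (\<Union>L) + 1 \<le> card J + 2 * \<kappa>" using L(3) cL by simp
      have k2: "\<kappa> * card (\<Union>J) \<le> \<kappa> * card (\<Union>L)" using le by simp
      have tJ: "tight \<kappa> J" using sp k1 k2 \<open>J \<noteq> {}\<close> unfolding tight_def by linarith
      have "\<kappa> * card (\<Union>L) = \<kappa> * card (\<Union>J)" using sp k1 k2 by linarith
      then have "card (\<Union>J) = card (\<Union>L)" using \<kappa> by simp
      then have "\<Union>J = \<Union>L" using fU unfolding LJ by (intro card_subset_eq) auto
      then have "e \<subseteq> \<Union>J" unfolding LJ by auto
      moreover obtain T where "T \<in> \<T>" "J \<subseteq> T" using ex[OF JI tJ] by blast
      ultimately show ?thesis by (meson Union_mono order_trans)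
    qed
  qed (rule nm)
qed

text \<open>A tight set \<open>T\<close> has as many edges as a sparse set on the vertices
  \<open>\<Union>T\<close> can possibly have, so a cover of \<open>I\<close> by such vertex sets
  bounds its size.\<close>

lemma card_le_blocks:
  assumes "finite \<T>" "\<And>T. T \<in> \<T> \<Longrightarrow> T \<subseteq> E" "\<And>T. T \<in> \<T> \<Longrightarrow> tight \<kappa> T"
    and "\<And>e. e \<in> I \<Longrightarrow> \<exists>T\<in>\<T>. e \<subseteq> \<Union>T" "I \<subseteq> E" "sparse \<kappa> I"
  shows "card I \<le> (\<Sum>T\<in>\<T>. card T)"
proof -
  have "card {e\<in>I. e \<subseteq> \<Union>T} \<le> card T" if T: "T \<in> \<T>" for T
  proof (cases "{e\<in>I. e \<subseteq> \<Union>T} = {}")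
    case True then show ?thesis by (metis card.empty le0)
  next
    case False
    have "card (\<Union>{e\<in>I. e \<subseteq> \<Union>T}) \<le> card (\<Union>T)"
      using finite_Union_edges[OF assms(2)[OF T]] by (intro card_mono) auto
    then have "\<kappa> * card (\<Union>{e\<in>I. e \<subseteq> \<Union>T}) \<le> \<kappa> * card (\<Union>T)" by simp
    moreover have "card {e\<in>I. e \<subseteq> \<Union>T} + 2 * \<kappa> \<le> \<kappa> * card (\<Union>{e\<in>I. e \<subseteq> \<Union>T}) + 1"
      by (rule sparseD[OF assms(6) _ False]) auto
    ultimately show ?thesis using assms(3)[OF T] unfolding tight_def by linarith
  qed
  then have "(\<Sum>T\<in>\<T>. card {e\<in>I. e \<subseteq> \<Union>T}) \<le> (\<Sum>T\<in>\<T>. card T)" by (rule sum_mono)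
  moreover have "card I \<le> card (\<Union>T\<in>\<T>. {e\<in>I. e \<subseteq> \<Union>T})"
    using assms(1,4) finite_edges[OF assms(5)] by (intro card_mono) auto
  moreover have "card (\<Union>T\<in>\<T>. {e\<in>I. e \<subseteq> \<Union>T}) \<le> (\<Sum>T\<in>\<T>. card {e\<in>I. e \<subseteq> \<Union>T})"
    by (rule card_UN_le[OF assms(1)])
  ultimately show ?thesis by linarith
qed

section \<open>The rank function of a count matroid\<close>

lemma card_le_sparse_rank: "I \<subseteq> Z \<Longrightarrow> Z \<subseteq> E \<Longrightarrow> sparse \<kappa> I \<Longrightarrow> card I \<le> sparse_rank \<kappa> Z"
  unfolding sparse_rank_def using finite_edges[of Z]
  by (intro Max_ge finite_imageI) (auto intro: finite_subset[of _ "Pow Z"])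

lemma sparse_rank_witness:
  assumes "Z \<subseteq> E" obtains I where "I \<subseteq> Z" "sparse \<kappa> I" "card I = sparse_rank \<kappa> Z"
proof -
  have "sparse_rank \<kappa> Z \<in> card ` {I. I \<subseteq> Z \<and> sparse \<kappa> I}"
    unfolding sparse_rank_def using finite_edges[OF assms] sparse_empty
    by (intro Max_in finite_imageI) (auto intro: finite_subset[of _ "Pow Z"])
  then show ?thesis using that by auto
qed

text \<open>Translates the condition on a colour class provided by \<open>rado_colouring\<close>
  into independence.\<close>

lemma sparse_if_card_le_rank:
  assumes "card J \<le> sparse_rank \<kappa> J" "J \<subseteq> E"
  shows "sparse \<kappa> J"
proof -
  obtain J' where J': "J' \<subseteq> J" "sparse \<kappa> J'" "card J' = sparse_rank \<kappa> J"
    using sparse_rank_witness[OF assms(2)] by metis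
  then have "J' = J" using assms finite_edges[OF assms(2)] by (intro card_seteq) auto
  with J' show ?thesis by simp
qed

lemma blocks_sum:
  assumes "\<Union>\<T> = I" "disjoint \<T>" "I \<subseteq> E"
  shows "finite \<T>" "(\<Sum>T\<in>\<T>. card T) = card I"
proof -
  show "finite \<T>" using assms finite_edges finite_UnionD by metis
  show "(\<Sum>T\<in>\<T>. card T) = card I"
    using card_Union_disjoint[of \<T>] assms finite_edges
    by (metis Union_upper order_trans)
qed

text \<open>This is the matroid property. The blocks of \<open>I\<close> span \<open>Z\<close>, so
  by \<open>card_le_blocks\<close> no sparse subset of \<open>Z\<close> exceeds the total size of
  the blocks, which is \<open>card I\<close>.\<close>

lemma card_maximal_sparse:
  assumes \<kappa>: "\<kappa> \<ge> 1" and Z: "Z \<subseteq> E" and I: "I \<subseteq> Z" "sparse \<kappa> I"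
    and max: "\<And>e. e \<in> Z - I \<Longrightarrow> \<not> sparse \<kappa> (insert e I)"
  shows "card I = sparse_rank \<kappa> Z"
proof -
  obtain \<T> where \<T>: "\<Union>\<T> = I" "disjoint \<T>" "\<And>T. T \<in> \<T> \<Longrightarrow> tight \<kappa> T"
    "\<And>e. e \<in> Z \<Longrightarrow> \<exists>T\<in>\<T>. e \<subseteq> \<Union>T"
    using maximal_sparse_blocks[OF assms] by metis
  have IE: "I \<subseteq> E" using I Z by auto
  obtain I' where I': "I' \<subseteq> Z" "sparse \<kappa> I'" "card I' = sparse_rank \<kappa> Z"
    using sparse_rank_witness[OF Z] by metis
  have "card I' \<le> (\<Sum>T\<in>\<T>. card T)"
    using \<T> I' Z IE by (intro card_le_blocks[where \<kappa>=\<kappa>] blocks_sum(1)[OF \<T>(1,2) IE]) auto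
  then show ?thesis
    using blocks_sum(2)[OF \<T>(1,2) IE] I'(3) card_le_sparse_rank[OF I(1) Z I(2)] by simp
qed

lemma extend_sparse:
  assumes "Z \<subseteq> E" "I \<subseteq> Z" "sparse \<kappa> I"
  obtains I' where "I \<subseteq> I'" "I' \<subseteq> Z" "sparse \<kappa> I'" "\<And>e. e \<in> Z - I' \<Longrightarrow> \<not> sparse \<kappa> (insert e I')"
proof -
  let ?A = "{J. J \<subseteq> Z \<and> sparse \<kappa> J}"
  have "finite ?A" using finite_edges[OF assms(1)] by (auto intro: finite_subset[of _ "Pow Z"])
  moreover have "I \<in> ?A" using assms by simp
  ultimately have "\<exists>J\<in>?A. I \<subseteq> J \<and> (\<forall>J'\<in>?A. J \<subseteq> J' \<longrightarrow> J = J')"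
    by (rule finite_has_maximal2)
  then obtain J where J: "J \<in> ?A" "I \<subseteq> J" "\<forall>J'\<in>?A. J \<subseteq> J' \<longrightarrow> J = J'" by auto
  show ?thesis
  proof (rule that[of J])
    fix e assume e: "e \<in> Z - J"
    show "\<not> sparse \<kappa> (insert e J)"
    proof
      assume "sparse \<kappa> (insert e J)"
      then have "insert e J \<in> ?A" using e J by auto
      then have "J = insert e J" using J(3) by (meson subset_insertI)
      then show False using e by auto
    qed
  qed (use J in auto)
qed

lemma sparse_rank_mono:
  assumes "A \<subseteq> B" "B \<subseteq> E" shows "sparse_rank \<kappa> A \<le> sparse_rank \<kappa> B"
proof -
  have "A \<subseteq> E" using assms by auto
  then obtain I where "I \<subseteq> A" "sparse \<kappa> I" "card I = sparse_rank \<kappa> A"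
    using sparse_rank_witness[of A] by metis
  then show ?thesis using card_le_sparse_rank[of I B] assms by auto
qed

text \<open>The usual basis argument: a maximum sparse set \<open>I0\<close> in
  \<open>A \<inter> B\<close> is extended within \<open>A\<close> and then within
  \<open>A \<union> B\<close> to \<open>I2\<close>. The traces of \<open>I2\<close> on
  \<open>A\<close> and \<open>B\<close> are sparse and both contain \<open>I0\<close>.\<close>

lemma sparse_rank_submodular:
  assumes \<kappa>: "\<kappa> \<ge> 1" and A: "A \<subseteq> E" and B: "B \<subseteq> E"
  shows "sparse_rank \<kappa> (A \<union> B) + sparse_rank \<kappa> (A \<inter> B) \<le> sparse_rank \<kappa> A + sparse_rank \<kappa> B"
proof -
  have AB: "A \<inter> B \<subseteq> E" "A \<union> B \<subseteq> E" using A B by auto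
  obtain I0 where I0: "I0 \<subseteq> A \<inter> B" "sparse \<kappa> I0" "card I0 = sparse_rank \<kappa> (A \<inter> B)"
    using sparse_rank_witness[OF AB(1)] by metis
  obtain I1 where I1: "I0 \<subseteq> I1" "I1 \<subseteq> A" "sparse \<kappa> I1"
      "\<And>e. e \<in> A - I1 \<Longrightarrow> \<not> sparse \<kappa> (insert e I1)"
    using extend_sparse[OF A _ I0(2)] I0(1) by (metis le_inf_iff)
  have "I1 \<subseteq> A \<union> B" using I1 by auto
  then obtain I2 where I2: "I1 \<subseteq> I2" "I2 \<subseteq> A \<union> B" "sparse \<kappa> I2"
      "\<And>e. e \<in> A \<union> B - I2 \<Longrightarrow> \<not> sparse \<kappa> (insert e I2)"
    using extend_sparse[OF AB(2) _ I1(3)] by metis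
  have c1: "card I1 = sparse_rank \<kappa> A" by (rule card_maximal_sparse[OF \<kappa> A I1(2,3,4)])
  have c2: "card I2 = sparse_rank \<kappa> (A \<union> B)" by (rule card_maximal_sparse[OF \<kappa> AB(2) I2(2,3,4)])
  have f2: "finite I2" using I2(2) AB(2) finite_edges by (meson order_trans)
  have "card (I2 \<inter> A) \<le> sparse_rank \<kappa> A"
    by (rule card_le_sparse_rank[OF _ A sparse_subset[OF I2(3)]]) auto
  moreover have "card (I2 \<inter> B) \<le> sparse_rank \<kappa> B"
    by (rule card_le_sparse_rank[OF _ B sparse_subset[OF I2(3)]]) auto
  moreover have "card ((I2 \<inter> A) \<union> (I2 \<inter> B)) + card ((I2 \<inter> A) \<inter> (I2 \<inter> B)) = card (I2 \<inter> A) + card (I2 \<inter> B)"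
    using card_Un_Int[of "I2 \<inter> A" "I2 \<inter> B"] f2 by simp
  moreover have "(I2 \<inter> A) \<union> (I2 \<inter> B) = I2" using I2(2) by auto
  moreover have "card I0 \<le> card ((I2 \<inter> A) \<inter> (I2 \<inter> B))"
    using I0(1) I1(1) I2(1) f2 by (intro card_mono) auto
  ultimately show ?thesis using c2 I0(3) by simp
qed

text \<open>For \<open>\<kappa> = 1\<close> the blocks are spanning trees of the nontrivial
  components of \<open>Z\<close>. Two blocks whose union is not tight share \<open>c\<close>
  vertices with \<open>\<kappa> * c + 2 \<le> 2 * \<kappa>\<close>, which forces
  \<open>c = 0\<close> for \<open>\<kappa> = 1\<close>; for larger \<open>\<kappa>\<close> a common
  vertex is possible.\<close>

lemma sparse_rank_blocks:
  assumes \<kappa>: "\<kappa> \<ge> 1" and Z: "Z \<subseteq> E"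
  obtains \<T> where "finite \<T>" "\<And>T. T \<in> \<T> \<Longrightarrow> T \<subseteq> Z \<and> tight \<kappa> T \<and> sparse \<kappa> T"
    "\<And>e. e \<in> Z \<Longrightarrow> \<exists>T\<in>\<T>. e \<subseteq> \<Union>T"
    "\<And>T T'. \<kappa> = 1 \<Longrightarrow> T \<in> \<T> \<Longrightarrow> T' \<in> \<T> \<Longrightarrow> T \<noteq> T' \<Longrightarrow> \<Union>T \<inter> \<Union>T' = {}"
    "(\<Sum>T\<in>\<T>. card T) = sparse_rank \<kappa> Z"
proof -
  obtain I where I: "I \<subseteq> Z" "sparse \<kappa> I" "\<And>e. e \<in> Z - I \<Longrightarrow> \<not> sparse \<kappa> (insert e I)"
    using extend_sparse[OF Z _ sparse_empty] by (metis empty_subsetI)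
  obtain \<T> where \<T>: "\<Union>\<T> = I" "disjoint \<T>" "\<And>T. T \<in> \<T> \<Longrightarrow> tight \<kappa> T"
    "\<And>e. e \<in> Z \<Longrightarrow> \<exists>T\<in>\<T>. e \<subseteq> \<Union>T"
    "\<And>T T'. T \<in> \<T> \<Longrightarrow> T' \<in> \<T> \<Longrightarrow> T \<noteq> T' \<Longrightarrow> \<not> tight \<kappa> (T \<union> T')"
    using maximal_sparse_blocks[OF \<kappa> Z I] by metis
  have IE: "I \<subseteq> E" using I Z by auto
  have disj: "\<Union>T \<inter> \<Union>T' = {}"
    if \<kappa>1: "\<kappa> = 1" and T: "T \<in> \<T>" "T' \<in> \<T>" "T \<noteq> T'" for T T'
  proof -
    have TI: "T \<subseteq> I" "T' \<subseteq> I" using T \<T>(1) by auto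
    have "T \<inter> T' = {}" using T \<T>(2) unfolding disjoint_def by blast
    then have c: "card (T \<union> T') = card T + card T'"
      using TI IE finite_edges by (intro card_Un_disjoint) auto
    have fU: "finite (\<Union>T)" "finite (\<Union>T')" using TI IE finite_Union_edges by (meson order_trans)+
    have ne: "T \<union> T' \<noteq> {}" using \<T>(3)[OF T(1)] unfolding tight_def by auto
    have "card (T \<union> T') + 2 * \<kappa> \<le> \<kappa> * card (\<Union>(T \<union> T')) + 1"
      using TI ne by (intro sparseD[OF I(2)]) auto
    moreover have "card (T \<union> T') + 2 * \<kappa> \<noteq> \<kappa> * card (\<Union>(T \<union> T')) + 1"
      using \<T>(5)[OF T] ne unfolding tight_def by auto
    ultimately have lt: "card (T \<union> T') + 2 * \<kappa> \<le> \<kappa> * card (\<Union>(T \<union> T'))" by simp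
    have "card (\<Union>(T \<union> T')) + card (\<Union>T \<inter> \<Union>T') = card (\<Union>T) + card (\<Union>T')"
      using card_Un_Int[OF fU] by (simp add: Union_Un_distrib)
    then have "\<kappa> * card (\<Union>(T \<union> T')) + \<kappa> * card (\<Union>T \<inter> \<Union>T') = \<kappa> * card (\<Union>T) + \<kappa> * card (\<Union>T')"
      by (metis add_mult_distrib2)
    then have "\<kappa> * card (\<Union>T \<inter> \<Union>T') + 2 \<le> 2 * \<kappa>"
      using lt c \<T>(3)[OF T(1)] \<T>(3)[OF T(2)] unfolding tight_def by linarith
    then have "card (\<Union>T \<inter> \<Union>T') = 0" using \<kappa>1 by simp
    then show ?thesis using fU by (simp add: card_eq_0_iff)
  qed
  show ?thesis
  proof (rule that[of \<T>])
    show "finite \<T>" by (rule blocks_sum(1)[OF \<T>(1,2) IE])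
    show "T \<subseteq> Z \<and> tight \<kappa> T \<and> sparse \<kappa> T" if "T \<in> \<T>" for T
    proof -
      have "T \<subseteq> I" using that \<T>(1) by auto
      then show ?thesis using \<T>(3)[OF that] sparse_subset[OF I(2)] I(1) by blast
    qed
    show "\<exists>T\<in>\<T>. e \<subseteq> \<Union>T" if "e \<in> Z" for e by (rule \<T>(4)[OF that])
    show "\<Union>T \<inter> \<Union>T' = {}" if "\<kappa> = 1" "T \<in> \<T>" "T' \<in> \<T>" "T \<noteq> T'" for T T' by (rule disj[OF that])
    show "(\<Sum>T\<in>\<T>. card T) = sparse_rank \<kappa> Z"
      using blocks_sum(2)[OF \<T>(1,2) IE] card_maximal_sparse[OF \<kappa> Z I] by simp
  qed
qed

text \<open>Places each rigid block inside one component. If some edges of \<open>T\<close> were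
  outside \<open>Y\<close>, the sparsity bounds for the edges inside and outside would add up to
  \<open>2 * \<kappa> - 1\<close> less than tightness demands.\<close>

lemma tight_connected:
  assumes T: "tight \<kappa> T" "sparse \<kappa> T" "T \<subseteq> E" and \<kappa>: "\<kappa> \<ge> 1"
    and cover: "\<And>e. e \<in> T \<Longrightarrow> \<exists>Y\<in>\<Y>. e \<subseteq> Y"
    and disj: "\<And>Y Y'. Y \<in> \<Y> \<Longrightarrow> Y' \<in> \<Y> \<Longrightarrow> Y \<noteq> Y' \<Longrightarrow> Y \<inter> Y' = {}"
  shows "\<exists>Y\<in>\<Y>. \<Union>T \<subseteq> Y"
proof -
  obtain e where e: "e \<in> T" using T unfolding tight_def by auto
  then obtain Y where Y: "Y \<in> \<Y>" "e \<subseteq> Y" using cover by blast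
  define T0 where "T0 = {e\<in>T. e \<subseteq> Y}"
  have "T - T0 = {}"
  proof (rule ccontr)
    assume ne: "T - T0 \<noteq> {}"
    have "card T0 + 2 * \<kappa> \<le> \<kappa> * card (\<Union>T0) + 1"
      using e Y(2) by (intro sparseD[OF T(2)]) (auto simp: T0_def)
    moreover have "card (T - T0) + 2 * \<kappa> \<le> \<kappa> * card (\<Union>(T - T0)) + 1"
      using ne by (intro sparseD[OF T(2)]) auto
    moreover have "card T = card T0 + card (T - T0)"
      using finite_edges[OF T(3)] by (subst card_Diff_subset) (auto simp: T0_def card_mono finite_subset)
    moreover have "card (\<Union>T) = card (\<Union>T0) + card (\<Union>(T - T0))"
    proof -
      have "\<Union>T0 \<inter> \<Union>(T - T0) = {}"
      proof -
        have "Y \<inter> e' = {}" if "e' \<in> T - T0" for e'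
        proof -
          obtain Y' where Y': "Y' \<in> \<Y>" "e' \<subseteq> Y'" using cover[of e'] \<open>e' \<in> T - T0\<close> by blast
          then have "Y' \<noteq> Y" using that unfolding T0_def by auto
          with disj[OF Y(1) Y'(1)] Y'(2) show ?thesis by blast
        qed
        then show ?thesis unfolding T0_def by blast
      qed
      moreover have "finite (\<Union>T0)" "finite (\<Union>(T - T0))"
        using T(3) by (auto intro!: finite_Union_edges simp: T0_def)
      moreover have "\<Union>T = \<Union>T0 \<union> \<Union>(T - T0)" unfolding T0_def by auto
      ultimately show ?thesis by (simp add: card_Un_disjoint)
    qed
    then have "\<kappa> * card (\<Union>T) = \<kappa> * card (\<Union>T0) + \<kappa> * card (\<Union>(T - T0))"
      by (simp add: add_mult_distrib2)
    ultimately show False using T(1) \<kappa> unfolding tight_def by linarith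
  qed
  then have "\<Union>T \<subseteq> Y" unfolding T0_def by blast
  with Y(1) show ?thesis by blast
qed

end

section \<open>Trees and rigid graphs\<close>

lemma simple_graph_pair_family:
  assumes "simple_graph V E" shows "pair_family E"
proof
  have "E \<subseteq> Pow V" using assms unfolding simple_graph_def by auto
  then show "finite E" using assms finite_subset unfolding simple_graph_def by blast
  show "card e = 2" if "e \<in> E" for e using assms that unfolding simple_graph_def by auto
qed

lemma sum_degree:
  assumes "finite F" "finite A"
  shows "(\<Sum>v\<in>A. degree F v) = (\<Sum>e\<in>F. card (e \<inter> A))"
proof -
  have "(\<Sum>v\<in>A. degree F v) = (\<Sum>v\<in>A. \<Sum>e\<in>{e\<in>F. v \<in> e}. 1)"
    by (simp add: degree_def)
  also have "\<dots> = (\<Sum>e\<in>F. \<Sum>v\<in>{v\<in>A. v \<in> e}. 1)"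
    by (rule sum.swap_restrict[OF assms(2,1)])
  also have "\<dots> = (\<Sum>e\<in>F. card (e \<inter> A))"
    by (intro sum.cong refl) (simp add: Int_def conj_commute)
  finally show ?thesis .
qed

text \<open>Were the graph disconnected, a set of reachable vertices and its complement would
  together carry at most \<open>card V - 2\<close> edges. A cycle has as many edges as vertices, one
  more than sparsity allows.\<close>

lemma tree_if_sparse:
  assumes V: "finite V" "V \<noteq> {}" and T: "\<And>e. e \<in> T \<Longrightarrow> e \<subseteq> V \<and> card e = 2"
    and sp: "sparse 1 T" and c: "card T + 1 = card V"
  shows "is_tree V T"
proof -
  have "T \<subseteq> Pow V" using T by auto
  then have fT: "finite T" using V(1) finite_subset by blast
  have bound: "card {e\<in>T. e \<subseteq> R} + 1 \<le> card R" if "R \<subseteq> V" "R \<noteq> {}" for R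
  proof (cases "{e\<in>T. e \<subseteq> R} = {}")
    case True
    have "card R > 0" using that V(1) finite_subset by (auto simp: card_gt_0_iff)
    with True show ?thesis by (metis One_nat_def Suc_leI add_0 card.empty)
  next
    case False
    have "card (\<Union>{e\<in>T. e \<subseteq> R}) \<le> card R"
      using that V(1) finite_subset by (intro card_mono) blast+
    moreover have "card {e\<in>T. e \<subseteq> R} + 2 * 1 \<le> 1 * card (\<Union>{e\<in>T. e \<subseteq> R}) + 1"
      by (rule sparseD[OF sp _ False]) auto
    ultimately show ?thesis by linarith
  qed
  have conn: "connected_graph V T" unfolding connected_graph_def
  proof (intro ballI, rule ccontr)
    fix u v assume u: "u \<in> V" and v: "v \<in> V"
    let ?r = "{(x, y). {x, y} \<in> T}"
    assume nr: "(u, v) \<notin> ?r\<^sup>*"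
    define R where "R = {x\<in>V. (u, x) \<in> ?r\<^sup>*}"
    have uR: "u \<in> R" and vR: "v \<in> V - R" using u v nr unfolding R_def by auto
    have "e \<subseteq> R \<or> e \<subseteq> V - R" if e: "e \<in> T" for e
    proof -
      obtain x y where xy: "e = {x, y}" using T[OF e] by (metis card_2_iff)
      have "(x, y) \<in> ?r" "(y, x) \<in> ?r" using e xy by (auto simp: insert_commute)
      moreover have "x \<in> V" "y \<in> V" using T[OF e] xy by auto
      ultimately show ?thesis unfolding R_def xy
        by (auto intro: rtrancl_into_rtrancl[of u x ?r y] rtrancl_into_rtrancl[of u y ?r x])
    qed
    then have "T \<subseteq> {e\<in>T. e \<subseteq> R} \<union> {e\<in>T. e \<subseteq> V - R}" by auto
    then have "card T \<le> card ({e\<in>T. e \<subseteq> R} \<union> {e\<in>T. e \<subseteq> V - R})"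
      using fT by (intro card_mono) auto
    also have "\<dots> \<le> card {e\<in>T. e \<subseteq> R} + card {e\<in>T. e \<subseteq> V - R}" by (rule card_Un_le)
    finally have "card T \<le> card {e\<in>T. e \<subseteq> R} + card {e\<in>T. e \<subseteq> V - R}" .
    moreover have RV: "R \<subseteq> V" unfolding R_def by auto
    then have "card {e\<in>T. e \<subseteq> R} + 1 \<le> card R" using uR by (intro bound) auto
    moreover have "card {e\<in>T. e \<subseteq> V - R} + 1 \<le> card (V - R)" using vR by (intro bound) auto
    moreover have "card (V - R) + card R = card V"
      using card_Diff_subset[OF finite_subset[OF RV V(1)] RV] card_mono[OF V(1) RV] by simp
    ultimately show False using c by linarith
  qed
  have acyc: "\<not> is_cycle T xs" for xs
  proof
    assume cyc: "is_cycle T xs"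
    define L where "L = length xs"
    define f where "f i = {xs ! i, xs ! (Suc i mod L)}" for i
    have L: "L \<ge> 3" and d: "distinct xs" and fT': "\<And>i. i < L \<Longrightarrow> f i \<in> T"
      using cyc unfolding is_cycle_def L_def f_def by auto
    have "inj_on f {..<L}"
    proof (rule inj_onI)
      fix i j assume ij: "i \<in> {..<L}" "j \<in> {..<L}" "f i = f j"
      have m: "Suc i mod L < L" "Suc j mod L < L" using L by auto
      have *: "xs ! a = xs ! b \<longleftrightarrow> a = b" if "a < L" "b < L" for a b
        using d that nth_eq_iff_index_eq unfolding L_def by blast
      \<comment> \<open>Two positions carry the same edge only if they coincide or each is the
        cyclic successor of the other; the latter needs a length of at most 2.\<close>
      have "i = j \<or> (i = Suc j mod L \<and> Suc i mod L = j)"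
        using ij m * unfolding f_def doubleton_eq_iff by auto
      moreover have "\<not> (i = Suc j mod L \<and> Suc i mod L = j)"
      proof
        assume a: "i = Suc j mod L \<and> Suc i mod L = j"
        show False
        proof (cases "Suc j = L")
          case True
          with a L show False by auto
        next
          case False
          then have "i = Suc j" using a ij(2) by auto
          then show False using a ij(1) L by (cases "Suc i = L") auto
        qed
      qed
      ultimately show "i = j" by blast
    qed
    then have cL: "card (f ` {..<L}) = L" by (simp add: card_image)
    have "\<Union>(f ` {..<L}) \<subseteq> set xs"
      using L unfolding f_def L_def by (auto intro!: nth_mem mod_less_divisor)
    then have "card (\<Union>(f ` {..<L})) \<le> card (set xs)" by (intro card_mono) auto
    also have "\<dots> = L" using d distinct_card unfolding L_def by blast
    finally have "card (\<Union>(f ` {..<L})) \<le> L" .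
    moreover have "card (f ` {..<L}) + 2 * 1 \<le> 1 * card (\<Union>(f ` {..<L})) + 1"
      using L fT' by (intro sparseD[OF sp]) (auto simp: lessThan_empty_iff)
    ultimately show False using cL by linarith
  qed
  show ?thesis unfolding is_tree_def simple_graph_def using V T conn acyc by blast
qed

lemma k_rigid_if_sparse:
  assumes V: "finite V" "card V \<ge> 2" and R: "\<And>e. e \<in> R \<Longrightarrow> e \<subseteq> V \<and> card e = 2" and k: "k \<ge> 1"
    and sp: "sparse k R" and c: "card R + 2 * k = k * card V + 1"
  shows "k_rigid k V R"
proof -
  have "int (induced_edge_count R X) \<le> int k * int (card X) - ell k X" if X: "X \<subseteq> V" "X \<noteq> {}" for X
  proof -
    have fX: "finite X" using X V finite_subset by blast
    then have X1: "card X \<ge> 1" using X by (simp add: Suc_leI card_gt_0_iff)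
    show ?thesis
    proof (cases "{e\<in>R. e \<subseteq> X} = {}")
      case True
      \<comment> \<open>\<open>sparse\<close> speaks of nonempty edge sets only. For
        \<open>X\<close> without edges the bound reads \<open>0 \<le> k - k\<close> on a single
        vertex and follows from \<open>card X \<ge> 2\<close> otherwise.\<close>
      have "int k * 2 \<le> int k * int (card X)" if "card X \<noteq> 1"
        using that X1 by (intro mult_left_mono) auto
      then show ?thesis unfolding induced_edge_count_def ell_def True by auto
    next
      case False
      then obtain e where e: "e \<in> R" "e \<subseteq> X" by blast
      then have "card X \<ge> 2" using R[OF e(1)] card_mono[OF fX e(2)] by simp
      moreover have "card (\<Union>{e\<in>R. e \<subseteq> X}) \<le> card X" using fX by (intro card_mono) auto
      then have "k * card (\<Union>{e\<in>R. e \<subseteq> X}) \<le> k * card X" by simp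
      moreover have "card {e\<in>R. e \<subseteq> X} + 2 * k \<le> k * card (\<Union>{e\<in>R. e \<subseteq> X}) + 1"
        by (rule sparseD[OF sp _ False]) auto
      ultimately have "card {e\<in>R. e \<subseteq> X} + 2 * k \<le> k * card X + 1" and "card X \<noteq> 1" by linarith+
      then show ?thesis unfolding induced_edge_count_def ell_def
        by (simp flip: of_nat_mult)
    qed
  qed
  moreover have "int (card R) = int k * int (card V) - ell k V"
  proof -
    have "int (card R) + 2 * int k = int k * int (card V) + 1" using c
      by (metis of_nat_1 of_nat_add of_nat_mult of_nat_numeral)
    then show ?thesis using V(2) unfolding ell_def by simp
  qed
  moreover have "simple_graph V R" unfolding simple_graph_def using V R by auto
  ultimately show ?thesis unfolding k_rigid_def by blast
qed

section \<open>The rank inequality\<close>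

locale weakly_connected_graph =
  fixes V :: "'a set" and E :: "'a set set" and k p m :: nat
  assumes k: "k \<ge> 2" and graph: "simple_graph V E" and two: "card V \<ge> 2"
    and weak: "weakly_connected k (4 * int k * int p - 2 * int p + 2 * int m) V E"
begin

sublocale pair_family E by (rule simple_graph_pair_family[OF graph])

text \<open>
  The number of edges at \<open>v\<close> to be discarded; by \<open>slack_bound\<close> below, the subtraction never truncates.
\<close>

definition slack :: "'a \<Rightarrow> nat" where
  "slack v = degree E v div 2 - (k * p + m)"

lemma finite_V: "finite V" using graph unfolding simple_graph_def by blast

lemma edge_subset: "e \<in> E \<Longrightarrow> e \<subseteq> V" using graph unfolding simple_graph_def by blast

text \<open>By the last assumption every edge of \<open>G - B\<close> leaving \<open>A\<close> lies
  outside \<open>Z\<close>, so each edge counted by weak connectivity contributes a half-edge at a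
  vertex of \<open>A\<close>.\<close>

lemma sum_degree_ge:
  assumes A: "A \<noteq> {}" "A \<inter> B = {}" "A \<union> B \<subset> V" and Z: "Z \<subseteq> E"
    and no: "\<And>e. e \<in> Z \<Longrightarrow> e \<inter> B = {} \<Longrightarrow> card (e \<inter> A) \<noteq> 1"
  shows "int (\<Sum>v\<in>A. degree (E - Z) v) \<ge> 4 * int k * int p - 2 * int p + 2 * int m - int k * int (card B)"
proof -
  have fA: "finite A" using A finite_V by (meson finite_subset le_supE psubsetE)
  let ?C = "{e\<in>delete_vertices E B. card (e \<inter> A) = 1}"
  have sub: "?C \<subseteq> E - Z" using no unfolding delete_vertices_def by auto
  have "4 * int k * int p - 2 * int p + 2 * int m - int k * int (card B) \<le> int (card ?C)"
    using weak A unfolding weakly_connected_def cut_degree_def by blast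
  also have "card ?C = (\<Sum>e\<in>?C. card (e \<inter> A))" by simp
  also have "(\<Sum>e\<in>?C. card (e \<inter> A)) \<le> (\<Sum>e\<in>E - Z. card (e \<inter> A))"
    using sub finite_E by (intro sum_mono2) auto
  also have "\<dots> = (\<Sum>v\<in>A. degree (E - Z) v)"
    using finite_E fA by (intro sum_degree[symmetric]) auto
  finally show ?thesis by simp
qed

lemma degree_ge:
  assumes v: "v \<in> V"
  shows "int (degree E v) \<ge> 4 * int k * int p - 2 * int p + 2 * int m"
proof -
  have "{v} \<union> {} \<noteq> V" using two by auto
  then show ?thesis using sum_degree_ge[of "{v}" "{}" "{}"] v by auto
qed

lemma kp_bounds: "2 * int k * int p \<ge> 2 * int p + int p * int k"
proof -
  have "2 * int p \<le> int k * int p" using k by (intro mult_right_mono) auto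
  then show ?thesis by (simp add: algebra_simps)
qed

lemma slack_bound:
  assumes v: "v \<in> V"
  shows "2 * (int (slack v) + int k * int p + int m) \<le> int (degree E v)"
proof -
  have "2 * int k * int p + 2 * int m \<le> int (degree E v)"
    using degree_ge[OF v] kp_bounds by (simp add: algebra_simps)
  then have "int (2 * (k * p + m)) \<le> int (degree E v)" by (simp add: algebra_simps)
  then have "k * p + m \<le> degree E v div 2" by (simp only: of_nat_le_iff) simp
  then have "2 * (slack v + k * p + m) \<le> degree E v" unfolding slack_def by simp
  then have "int (2 * (slack v + k * p + m)) \<le> int (degree E v)" by (simp only: of_nat_le_iff)
  then show ?thesis by simp
qed

text \<open>The rank inequality with a family \<open>\<T>\<close> of large rigid blocks in place of
  \<open>sparse_rank k Z\<close>. It is proved in doubled form: \<open>D v\<close> counts the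
  half-edges at \<open>v\<close> of edges outside \<open>Z\<close>, and the vertices outside and
  inside \<open>U\<close> are treated separately.\<close>

lemma block_count:
  assumes Z: "Z \<subseteq> E"
    and fin\<T>: "finite \<T>" and \<T>: "\<And>T. T \<in> \<T> \<Longrightarrow> T \<subseteq> Z \<and> tight k T \<and> sparse k T \<and> card (\<Union>T) \<ge> 4"
    and cover: "p = 0 \<or> (\<forall>e\<in>Z. \<exists>T\<in>\<T>. e \<subseteq> \<Union>T)"
  shows "int m * (int (card V) - 1) + int p * (int k * int (card V) - 2 * int k + 1) + int (\<Sum>v\<in>V. slack v)
       \<le> int (card (E - Z)) + int m * int (sparse_rank 1 Z) + int p * int (\<Sum>T\<in>\<T>. card T)
         + int (\<Sum>v\<in>\<Union>Z. slack v)"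
proof -
  \<comment> \<open>\<open>2 * c\<close> is the part of a degree guaranteed beyond twice the slack,
    and \<open>2 * c'\<close> is the assumed connectivity.\<close>
  define c where "c = int k * int p + int m"
  define c' where "c' = 2 * int k * int p - int p + int m"
  define D where "D v = int (degree (E - Z) v)" for v
  define U where "U = \<Union>Z"
  have UV: "U \<subseteq> V" using Z edge_subset unfolding U_def by blast
  have fU: "finite U" using UV finite_V finite_subset by blast
  have D0: "D v \<ge> 0" for v unfolding D_def by simp
  have "int p * int k \<ge> 0" by simp
  then have c'm: "c' \<ge> int m" using kp_bounds unfolding c'_def by linarith
  have cut: "(\<Sum>v\<in>A. D v) \<ge> 2 * c' - int k * int (card B)"
    if "A \<noteq> {}" "A \<inter> B = {}" "A \<union> B \<subset> V" "\<And>e. e \<in> Z \<Longrightarrow> e \<inter> B = {} \<Longrightarrow> card (e \<inter> A) \<noteq> 1" for A B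
    using sum_degree_ge[OF that(1-3) Z that(4)] unfolding D_def c'_def by simp
  have handshake: "(\<Sum>v\<in>V. D v) = 2 * int (card (E - Z))"
  proof -
    have "(\<Sum>v\<in>V. degree (E - Z) v) = (\<Sum>e\<in>E - Z. card (e \<inter> V))"
      using finite_E finite_V by (intro sum_degree) auto
    also have "\<dots> = (\<Sum>e\<in>E - Z. 2)"
      using edge_subset card2 by (intro sum.cong refl) (auto simp: Int_absorb2)
    finally have "(\<Sum>v\<in>V. degree (E - Z) v) = 2 * card (E - Z)" by simp
    then show ?thesis unfolding D_def by (metis of_nat_mult of_nat_numeral of_nat_sum)
  qed
  have outside: "(\<Sum>v\<in>V - U. D v) \<ge> 2 * (\<Sum>v\<in>V - U. int (slack v)) + 2 * c * int (card (V - U))"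
  proof -
    have "D v \<ge> 2 * int (slack v) + 2 * c" if v: "v \<in> V - U" for v
    proof -
      have "{e\<in>E - Z. v \<in> e} = {e\<in>E. v \<in> e}" using v unfolding U_def by auto
      then have "D v = int (degree E v)" unfolding D_def degree_def by simp
      then show ?thesis using slack_bound[of v] v unfolding c_def by simp
    qed
    then have "(\<Sum>v\<in>V - U. 2 * int (slack v) + 2 * c) \<le> (\<Sum>v\<in>V - U. D v)" by (rule sum_mono)
    then show ?thesis by (simp add: sum.distrib sum_distrib_left mult.commute)
  qed
  \<comment> \<open>\<open>\<Q>\<close> holds one spanning tree for each component of
    \<open>Z\<close> on the vertex set \<open>U\<close>, whence the rank
    \<open>card U - card \<Q>\<close> below.\<close>
  obtain \<Q> where fin\<Q>: "finite \<Q>" and \<Q>: "\<And>Q. Q \<in> \<Q> \<Longrightarrow> Q \<subseteq> Z \<and> tight 1 Q \<and> sparse 1 Q"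
    and \<Q>cover: "\<And>e. e \<in> Z \<Longrightarrow> \<exists>Q\<in>\<Q>. e \<subseteq> \<Union>Q"
    and \<Q>disj: "\<And>Q Q'. Q \<in> \<Q> \<Longrightarrow> Q' \<in> \<Q> \<Longrightarrow> Q \<noteq> Q' \<Longrightarrow> \<Union>Q \<inter> \<Union>Q' = {}"
    and \<Q>sum: "(\<Sum>Q\<in>\<Q>. card Q) = sparse_rank 1 Z"
  proof (rule sparse_rank_blocks[of 1 Z])
    fix \<Q>
    assume *: "finite \<Q>" "\<And>Q. Q \<in> \<Q> \<Longrightarrow> Q \<subseteq> Z \<and> tight 1 Q \<and> sparse 1 Q"
      "\<And>e. e \<in> Z \<Longrightarrow> \<exists>Q\<in>\<Q>. e \<subseteq> \<Union>Q"
      and disj: "\<And>Q Q'. 1 = (1 :: nat) \<Longrightarrow> Q \<in> \<Q> \<Longrightarrow> Q' \<in> \<Q> \<Longrightarrow> Q \<noteq> Q' \<Longrightarrow> \<Union>Q \<inter> \<Union>Q' = {}"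
      and sum: "(\<Sum>Q\<in>\<Q>. card Q) = sparse_rank 1 Z"
    show thesis by (rule that[OF * disj[OF refl] sum])
  qed (use Z in simp_all)
  have fUQ: "finite (\<Union>Q)" if "Q \<in> \<Q>" for Q
    using \<Q>[OF that] Z by (intro finite_Union_edges) auto
  have cardQ: "card Q + 1 = card (\<Union>Q)" if "Q \<in> \<Q>" for Q
    using \<Q>[OF that] unfolding tight_def by simp
  have UQne: "\<Union>Q \<noteq> {}" if "Q \<in> \<Q>" for Q
    using cardQ[OF that] by (metis add_is_0 card.empty one_neq_zero)
  have U\<Q>: "U = (\<Union>Q\<in>\<Q>. \<Union>Q)"
  proof
    show "U \<subseteq> (\<Union>Q\<in>\<Q>. \<Union>Q)" unfolding U_def using \<Q>cover by blast
    show "(\<Union>Q\<in>\<Q>. \<Union>Q) \<subseteq> U" unfolding U_def using \<Q> by blast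
  qed
  have cardU: "card U = (\<Sum>Q\<in>\<Q>. card (\<Union>Q))"
    unfolding U\<Q> by (intro card_UN_disjoint ballI impI fin\<Q> fUQ \<Q>disj)
  have rank1: "int (sparse_rank 1 Z) = int (card U) - int (card \<Q>)"
  proof -
    have "(\<Sum>Q\<in>\<Q>. card Q + 1) = card U" unfolding cardU by (intro sum.cong refl cardQ)
    then have "sparse_rank 1 Z + card \<Q> = card U" using \<Q>sum unfolding sum.distrib by simp
    then show ?thesis by linarith
  qed
  have Qcut: "(\<Sum>v\<in>\<Union>Q. D v) \<ge> 2 * int m" if Q: "Q \<in> \<Q>" "\<Union>Q \<noteq> V" for Q
  proof -
    have "card (e \<inter> \<Union>Q) \<noteq> 1" if e: "e \<in> Z" for e
    proof -
      obtain Q' where Q': "Q' \<in> \<Q>" "e \<subseteq> \<Union>Q'" using \<Q>cover[OF e] by blast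
      have "card e = 2" using e Z card2 by auto
      show ?thesis
      proof (cases "Q' = Q")
        case True
        then have "e \<inter> \<Union>Q = e" using Q'(2) by blast
        with \<open>card e = 2\<close> show ?thesis by simp
      next
        case False
        then have "e \<inter> \<Union>Q = {}" using \<Q>disj[OF Q'(1) Q(1)] Q'(2) by blast
        then show ?thesis by simp
      qed
    qed
    moreover have "\<Union>Q \<subseteq> V" using \<Q>[OF Q(1)] UV unfolding U_def by blast
    ultimately have "(\<Sum>v\<in>\<Union>Q. D v) \<ge> 2 * c' - int k * int (card ({}::'a set))"
      using Q UQne by (intro cut) auto
    then show ?thesis using c'm by simp
  qed
  \<comment> \<open>Weak connectivity says nothing about a component covering \<open>V\<close>. At
    most one component thus goes without its \<open>2 * m\<close> half-edges, and the term
    \<open>- 2 * c'\<close> in \<open>main\<close> can absorb this.\<close>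
  have whole: "card {Q\<in>\<Q>. \<Union>Q = V} \<le> 1"
  proof -
    have "Q = Q'" if "Q \<in> \<Q>" "Q' \<in> \<Q>" "\<Union>Q = V" "\<Union>Q' = V" for Q Q'
      using \<Q>disj[OF that(1,2)] UQne[OF that(1)] that(3,4) by (metis Int_absorb)
    then show ?thesis using fin\<Q> by (simp add: card_le_Suc0_iff_eq)
  qed
  have sum_UN: "(\<Sum>v\<in>(\<Union>Q\<in>\<R>. \<Union>Q). D v) = (\<Sum>Q\<in>\<R>. \<Sum>v\<in>\<Union>Q. D v)" if "\<R> \<subseteq> \<Q>" for \<R>
  proof (rule sum.UNION_disjoint)
    show "finite \<R>" using that fin\<Q> by (rule finite_subset)
    show "\<forall>Q\<in>\<R>. finite (\<Union>Q)" using that fUQ by auto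
    show "\<forall>Q\<in>\<R>. \<forall>Q'\<in>\<R>. Q \<noteq> Q' \<longrightarrow> \<Union>Q \<inter> \<Union>Q' = {}"
      by (intro ballI impI \<Q>disj) (use that in auto)
  qed
  \<comment> \<open>This is what remains of the doubled claim after inserting
    \<open>handshake\<close>, \<open>outside\<close> and \<open>rank1\<close>.\<close>
  have main: "(\<Sum>v\<in>U. D v) + 2 * int p * int (\<Sum>T\<in>\<T>. card T)
              \<ge> 2 * int p * int k * int (card U) + 2 * int m * int (card \<Q>) - 2 * c'"
  proof (cases "p = 0 \<or> (\<exists>T\<in>\<T>. \<Union>T = V)")
    case True
    \<comment> \<open>If \<open>p > 0\<close>, the block on \<open>V\<close> covers the terms with
      \<open>p\<close>; the components other than \<open>V\<close> give \<open>2 * m\<close>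
      half-edges each.\<close>
    define \<R> where "\<R> = {Q\<in>\<Q>. \<Union>Q \<noteq> V}"
    have "card \<Q> \<le> card (\<R> \<union> {Q\<in>\<Q>. \<Union>Q = V})"
      using fin\<Q> unfolding \<R>_def by (intro card_mono) auto
    also have "\<dots> \<le> card \<R> + card {Q\<in>\<Q>. \<Union>Q = V}" by (rule card_Un_le)
    finally have "card \<Q> \<le> card \<R> + card {Q\<in>\<Q>. \<Union>Q = V}" .
    then have "int (card \<Q>) \<le> int (card \<R>) + 1" using whole by simp
    then have "int m * int (card \<Q>) \<le> int m * (int (card \<R>) + 1)" by (intro mult_left_mono) auto
    moreover have "(\<Sum>Q\<in>\<R>. 2 * int m) \<le> (\<Sum>Q\<in>\<R>. \<Sum>v\<in>\<Union>Q. D v)"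
      using Qcut unfolding \<R>_def by (intro sum_mono) auto
    moreover have "(\<Sum>Q\<in>\<R>. \<Sum>v\<in>\<Union>Q. D v) = (\<Sum>v\<in>(\<Union>Q\<in>\<R>. \<Union>Q). D v)"
      by (rule sum_UN[symmetric]) (auto simp: \<R>_def)
    moreover have "\<dots> \<le> (\<Sum>v\<in>U. D v)"
      using fU D0 unfolding U\<Q> \<R>_def by (intro sum_mono2) auto
    ultimately have 1: "(\<Sum>v\<in>U. D v) \<ge> 2 * int m * int (card \<Q>) - 2 * int m"
      by (simp add: algebra_simps)
    have 2: "int p * int (\<Sum>T\<in>\<T>. card T) \<ge> int p * (int k * int (card U) - 2 * int k + 1)"
    proof (cases "p = 0")
      case False
      with True obtain T where T: "T \<in> \<T>" "\<Union>T = V" by blast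
      have "card T + 2 * k = k * card V + 1" using \<T>[OF T(1)] T(2) unfolding tight_def by simp
      moreover have "card T \<le> (\<Sum>T\<in>\<T>. card T)" using fin\<T> T(1) by (intro member_le_sum) auto
      moreover have "k * card U \<le> k * card V" using UV finite_V by (simp add: card_mono)
      ultimately have "k * card U + 1 \<le> (\<Sum>T\<in>\<T>. card T) + 2 * k" by linarith
      then have "int (k * card U + 1) \<le> int ((\<Sum>T\<in>\<T>. card T) + 2 * k)" by (simp only: of_nat_le_iff)
      then have "int k * int (card U) - 2 * int k + 1 \<le> int (\<Sum>T\<in>\<T>. card T)" by simp
      then show ?thesis by (intro mult_left_mono) auto
    qed simp
    show ?thesis using 1 2 unfolding c'_def by (simp add: algebra_simps)
  next
    case False
    then have p: "p \<ge> 1" and ne: "\<And>T. T \<in> \<T> \<Longrightarrow> \<Union>T \<noteq> V" by auto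
    have cov: "\<And>e. e \<in> Z \<Longrightarrow> \<exists>T\<in>\<T>. e \<subseteq> \<Union>T" using cover p by auto
    txt \<open>
      Weak connectivity is applied to the vertices \<open>A T\<close> lying in no block but \<open>T\<close>, after deleting
      the other vertices \<open>B T\<close> of \<open>T\<close>. A vertex of \<open>B T\<close> lies in at least two blocks, so each of
      them only has to pay for half of it.
    \<close>
    define A where "A T = {v\<in>\<Union>T. \<forall>T'\<in>\<T>. v \<in> \<Union>T' \<longrightarrow> T' = T}" for T
    define B where "B T = \<Union>T - A T" for T
    have TU: "\<Union>T \<subseteq> U" if "T \<in> \<T>" for T using \<T>[OF that] unfolding U_def by blast
    have fT: "finite (\<Union>T)" if "T \<in> \<T>" for T using TU[OF that] fU finite_subset by blast
    have AB: "A T \<union> B T = \<Union>T" "A T \<inter> B T = {}" for T unfolding A_def B_def by auto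
    have cAB: "card (\<Union>T) = card (A T) + card (B T)" if "T \<in> \<T>" for T
      using card_Un_disjoint[of "A T" "B T"] AB fT[OF that]
      by (metis finite_Un)
    have per: "2 * int p * int (card T) + (\<Sum>v\<in>A T. D v)
        \<ge> 2 * int p * int k * int (card (A T)) + int p * int k * int (card (B T))
          + (if A T \<noteq> {} then 2 * int m else 0)" if T: "T \<in> \<T>" for T
    proof -
      have "card T + 2 * k = k * (card (A T) + card (B T)) + 1"
        using \<T>[OF T] cAB[OF T] unfolding tight_def by simp
      then have "int (card T + 2 * k) = int (k * (card (A T) + card (B T)) + 1)" by simp
      then have cT: "int (card T) = int k * int (card (A T)) + int k * int (card (B T)) - 2 * int k + 1"
        by (simp add: algebra_simps)
      show ?thesis
      proof (cases "A T = {}")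
        case True
        \<comment> \<open>No half-edges are available here. Having at least four vertices makes
          \<open>2 * card T\<close> at least \<open>k * card (B T)\<close>.\<close>
        then have "card (B T) \<ge> 4" using \<T>[OF T] cAB[OF T] by simp
        then have "int k * 4 \<le> int k * int (card (B T))" by (intro mult_left_mono) auto
        then have "int k * int (card (B T)) \<le> 2 * int (card T)" using cT True by simp
        then have "int p * (int k * int (card (B T))) \<le> int p * (2 * int (card T))"
          by (intro mult_left_mono) auto
        then show ?thesis using True by (simp add: algebra_simps)
      next
        case ne': False
        have "card (e \<inter> A T) \<noteq> 1" if e: "e \<in> Z" "e \<inter> B T = {}" for e
        proof -
          obtain T' where T': "T' \<in> \<T>" "e \<subseteq> \<Union>T'" using cov[OF e(1)] by blast
          have c2: "card e = 2" using e Z card2 by auto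
          show ?thesis
          proof (cases "e \<inter> A T = {}")
            case True then show ?thesis by simp
          next
            case False
            then have "T' = T" using T' unfolding A_def by blast
            then have "e \<subseteq> A T" using T' e(2) AB(1)[of T] by blast
            then show ?thesis using c2 by (simp add: Int_absorb2)
          qed
        qed
        moreover have "A T \<union> B T \<subset> V" using AB(1)[of T] ne[OF T] TU[OF T] UV by blast
        ultimately have "(\<Sum>v\<in>A T. D v) \<ge> 2 * c' - int k * int (card (B T))"
          using ne' AB(2) by (intro cut) auto
        \<comment> \<open>The connectivity \<open>2 * c'\<close> cancels the constant in
          \<open>2 * p * card T\<close> and leaves \<open>2 * m\<close>. As
          \<open>p \<ge> 1\<close>, the loss from deleting \<open>B T\<close> is at most half of the
          term \<open>2 * p * k * card (B T)\<close>.\<close>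
        moreover have "1 * (int k * int (card (B T))) \<le> int p * (int k * int (card (B T)))"
          using p by (intro mult_right_mono) auto
        ultimately show ?thesis using ne' unfolding cT c'_def by (simp add: algebra_simps)
      qed
    qed
    have vertices: "2 * int (card U) \<le> (\<Sum>T\<in>\<T>. 2 * int (card (A T)) + int (card (B T)))"
    proof -
      \<comment> \<open>Double counting: a private vertex weighs 2 in its only block, a shared one
        weighs 1 in each of at least two blocks.\<close>
      define w where "w T v = (if v \<in> A T then 2 else 1 :: int)" for T v
      have "(\<Sum>T\<in>\<T>. 2 * int (card (A T)) + int (card (B T))) = (\<Sum>T\<in>\<T>. \<Sum>v\<in>\<Union>T. w T v)"
      proof (rule sum.cong[OF refl])
        fix T assume T: "T \<in> \<T>"
        have "(\<Sum>v\<in>\<Union>T. w T v) = (\<Sum>v\<in>A T. w T v) + (\<Sum>v\<in>B T. w T v)"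
          using AB[of T] fT[OF T] by (metis finite_Un sum.union_disjoint)
        also have "(\<Sum>v\<in>A T. w T v) = (\<Sum>v\<in>A T. 2)" by (intro sum.cong) (auto simp: w_def)
        also have "(\<Sum>v\<in>B T. w T v) = (\<Sum>v\<in>B T. 1)" by (intro sum.cong) (auto simp: w_def B_def)
        finally show "2 * int (card (A T)) + int (card (B T)) = (\<Sum>v\<in>\<Union>T. w T v)" by simp
      qed
      also have "\<dots> = (\<Sum>T\<in>\<T>. \<Sum>v\<in>{v\<in>U. v \<in> \<Union>T}. w T v)"
        using TU by (intro sum.cong refl) blast
      also have "\<dots> = (\<Sum>v\<in>U. \<Sum>T\<in>{T\<in>\<T>. v \<in> \<Union>T}. w T v)"
        by (rule sum.swap_restrict[OF fin\<T> fU])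
      also have "\<dots> \<ge> (\<Sum>v\<in>U. 2)"
      proof (rule sum_mono)
        fix v assume v: "v \<in> U"
        then obtain e where "e \<in> Z" "v \<in> e" unfolding U_def by blast
        then obtain T where T: "T \<in> \<T>" "v \<in> \<Union>T" using cov by blast
        have f: "finite {T\<in>\<T>. v \<in> \<Union>T}" using fin\<T> by simp
        have w0: "w T v \<ge> 0" for T unfolding w_def by simp
        show "2 \<le> (\<Sum>T\<in>{T\<in>\<T>. v \<in> \<Union>T}. w T v)"
        proof (cases "v \<in> A T")
          case True
          have "w T v \<le> (\<Sum>T\<in>{T\<in>\<T>. v \<in> \<Union>T}. w T v)"
            using T f w0 by (intro member_le_sum) auto
          then show ?thesis using True unfolding w_def by simp
        next
          case False
          then obtain T' where T': "T' \<in> \<T>" "v \<in> \<Union>T'" "T' \<noteq> T" using T unfolding A_def by blast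
          have "(\<Sum>S\<in>{T, T'}. w S v) \<le> (\<Sum>T\<in>{T\<in>\<T>. v \<in> \<Union>T}. w T v)"
            using T T' f w0 by (intro sum_mono2) auto
          moreover have "(\<Sum>S\<in>{T, T'}. w S v) \<ge> 2" using T'(3) unfolding w_def by simp
          ultimately show ?thesis by linarith
        qed
      qed
      finally show ?thesis by (simp add: mult.commute)
    qed
    define AA where "AA = (\<Union>T\<in>\<T>. A T)"
    \<comment> \<open>Apart from one that may cover \<open>V\<close>, each component needs its own
      \<open>2 * m\<close>. Those in \<open>\<R>\<close> avoid all private vertices and take it from
      \<open>Qcut\<close>; the others contain a block of \<open>\<S>\<close> and take its surplus
      from \<open>per\<close>.\<close>
    define \<R> where "\<R> = {Q\<in>\<Q>. \<Union>Q \<inter> AA = {} \<and> \<Union>Q \<noteq> V}"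
    define \<S> where "\<S> = {T\<in>\<T>. A T \<noteq> {}}"
    have fA: "finite (A T)" if "T \<in> \<T>" for T using fT[OF that] AB(1)[of T] by (metis finite_Un)
    have AAsum: "(\<Sum>v\<in>AA. D v) = (\<Sum>T\<in>\<T>. \<Sum>v\<in>A T. D v)"
      unfolding AA_def using fin\<T> fA by (intro sum.UNION_disjoint) (auto simp: A_def)
    have AAU: "AA \<subseteq> U" unfolding AA_def using TU AB(1) by blast
    have RU: "(\<Union>Q\<in>\<R>. \<Union>Q) \<subseteq> U" unfolding U\<Q> \<R>_def by auto
    have "(\<Sum>v\<in>AA. D v) + (\<Sum>v\<in>(\<Union>Q\<in>\<R>. \<Union>Q). D v) = (\<Sum>v\<in>AA \<union> (\<Union>Q\<in>\<R>. \<Union>Q). D v)"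
      using AAU RU fU finite_subset by (intro sum.union_disjoint[symmetric]) (auto simp: \<R>_def)
    also have "\<dots> \<le> (\<Sum>v\<in>U. D v)" using AAU RU fU D0 by (intro sum_mono2) auto
    also have "(\<Sum>v\<in>(\<Union>Q\<in>\<R>. \<Union>Q). D v) = (\<Sum>Q\<in>\<R>. \<Sum>v\<in>\<Union>Q. D v)"
      by (rule sum_UN) (auto simp: \<R>_def)
    finally have s1: "(\<Sum>T\<in>\<T>. \<Sum>v\<in>A T. D v) + (\<Sum>Q\<in>\<R>. \<Sum>v\<in>\<Union>Q. D v) \<le> (\<Sum>v\<in>U. D v)"
      unfolding AAsum .
    have s2: "2 * int m * int (card \<R>) \<le> (\<Sum>Q\<in>\<R>. \<Sum>v\<in>\<Union>Q. D v)"
    proof -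
      have "(\<Sum>Q\<in>\<R>. 2 * int m) \<le> (\<Sum>Q\<in>\<R>. \<Sum>v\<in>\<Union>Q. D v)"
        using Qcut unfolding \<R>_def by (intro sum_mono) auto
      then show ?thesis by (simp add: mult.commute)
    qed
    \<comment> \<open>A rigid block lies in a single component \<open>q T\<close>. Every component
      meeting \<open>AA\<close> is \<open>q T\<close> for some \<open>T\<close> with private
      vertices, so there are at most \<open>card \<S>\<close> of them.\<close>
    have "\<exists>q. \<forall>T\<in>\<T>. q T \<in> \<Q> \<and> \<Union>T \<subseteq> \<Union>(q T)"
    proof (rule bchoice, rule ballI)
      fix T assume T: "T \<in> \<T>"
      have "\<exists>Y\<in>Union ` \<Q>. \<Union>T \<subseteq> Y"
      proof (rule tight_connected[where \<kappa> = k])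
        show "tight k T" "sparse k T" "T \<subseteq> E" using \<T>[OF T] Z by auto
        show "k \<ge> 1" using k by simp
        show "\<exists>Y\<in>Union ` \<Q>. e \<subseteq> Y" if "e \<in> T" for e using \<Q>cover[of e] \<T>[OF T] that by blast
        show "Y \<inter> Y' = {}" if "Y \<in> Union ` \<Q>" "Y' \<in> Union ` \<Q>" "Y \<noteq> Y'" for Y Y'
          using that \<Q>disj by blast
      qed
      then show "\<exists>Q. Q \<in> \<Q> \<and> \<Union>T \<subseteq> \<Union>Q" by blast
    qed
    then obtain q where "\<forall>T\<in>\<T>. q T \<in> \<Q> \<and> \<Union>T \<subseteq> \<Union>(q T)" by (elim exE)
    note q = bspec[OF this]
    have "{Q\<in>\<Q>. \<Union>Q \<inter> AA \<noteq> {}} \<subseteq> q ` \<S>"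
    proof
      fix Q assume "Q \<in> {Q\<in>\<Q>. \<Union>Q \<inter> AA \<noteq> {}}"
      then obtain v T where Q: "Q \<in> \<Q>" and v: "v \<in> \<Union>Q" and T: "T \<in> \<T>" "v \<in> A T"
        unfolding AA_def by blast
      then have "v \<in> \<Union>(q T)" using q[OF T(1)] AB(1)[of T] by blast
      then have "q T = Q" using \<Q>disj[of "q T" Q] q[OF T(1)] Q v by blast
      then show "Q \<in> q ` \<S>" using T unfolding \<S>_def by blast
    qed
    moreover have f\<S>: "finite \<S>" using fin\<T> unfolding \<S>_def by simp
    ultimately have "card {Q\<in>\<Q>. \<Union>Q \<inter> AA \<noteq> {}} \<le> card \<S>" by (meson card_image_le card_mono finite_imageI order_trans)
    moreover have "card \<Q> \<le> card {Q\<in>\<Q>. \<Union>Q \<inter> AA \<noteq> {}} + card \<R> + card {Q\<in>\<Q>. \<Union>Q = V}"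
    proof -
      have "card \<Q> \<le> card ({Q\<in>\<Q>. \<Union>Q \<inter> AA \<noteq> {}} \<union> \<R> \<union> {Q\<in>\<Q>. \<Union>Q = V})"
        using fin\<Q> unfolding \<R>_def by (intro card_mono) auto
      also have "\<dots> \<le> card ({Q\<in>\<Q>. \<Union>Q \<inter> AA \<noteq> {}} \<union> \<R>) + card {Q\<in>\<Q>. \<Union>Q = V}"
        by (rule card_Un_le)
      also have "\<dots> \<le> card {Q\<in>\<Q>. \<Union>Q \<inter> AA \<noteq> {}} + card \<R> + card {Q\<in>\<Q>. \<Union>Q = V}"
        by (intro add_right_mono card_Un_le)
      finally show ?thesis .
    qed
    ultimately have "int (card \<Q>) \<le> int (card \<S>) + int (card \<R>) + 1" using whole by linarith
    then have s3: "2 * int m * int (card \<Q>) \<le> 2 * int m * (int (card \<S>) + int (card \<R>) + 1)"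
      by (intro mult_left_mono) auto
    have "(\<Sum>T\<in>\<T>. 2 * int p * int k * int (card (A T)) + int p * int k * int (card (B T))
          + (if A T \<noteq> {} then 2 * int m else 0)) \<le> (\<Sum>T\<in>\<T>. 2 * int p * int (card T) + (\<Sum>v\<in>A T. D v))"
      by (intro sum_mono per)
    moreover have "(\<Sum>T\<in>\<T>. 2 * int p * int k * int (card (A T)) + int p * int k * int (card (B T))
          + (if A T \<noteq> {} then 2 * int m else 0))
        = int p * int k * (\<Sum>T\<in>\<T>. 2 * int (card (A T)) + int (card (B T))) + 2 * int m * int (card \<S>)"
    proof -
      have "(\<Sum>T\<in>\<T>. if A T \<noteq> {} then 2 * int m else 0) = (\<Sum>T\<in>\<S>. 2 * int m)"
        unfolding \<S>_def by (rule sum.inter_filter[OF fin\<T>, symmetric])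
      then show ?thesis by (simp add: sum.distrib sum_distrib_left algebra_simps)
    qed
    moreover have "int p * int k * (2 * int (card U))
        \<le> int p * int k * (\<Sum>T\<in>\<T>. 2 * int (card (A T)) + int (card (B T)))"
      by (intro mult_left_mono vertices) auto
    moreover have "(\<Sum>T\<in>\<T>. 2 * int p * int (card T) + (\<Sum>v\<in>A T. D v))
        = 2 * int p * int (\<Sum>T\<in>\<T>. card T) + (\<Sum>T\<in>\<T>. \<Sum>v\<in>A T. D v)"
      by (simp add: sum.distrib sum_distrib_left)
    ultimately show ?thesis using s1 s2 s3 c'm by (simp add: algebra_simps)
  qed
  have "(\<Sum>v\<in>V. D v) = (\<Sum>v\<in>V - U. D v) + (\<Sum>v\<in>U. D v)"
    using sum.subset_diff[OF UV finite_V] by simp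
  then have 1: "2 * int (card (E - Z)) \<ge> 2 * (\<Sum>v\<in>V - U. int (slack v)) + 2 * c * int (card (V - U))
     + 2 * int p * int k * int (card U) + 2 * int m * int (card \<Q>) - 2 * c' - 2 * int p * int (\<Sum>T\<in>\<T>. card T)"
    using handshake outside main by linarith
  have 2: "int (card (V - U)) = int (card V) - int (card U)"
    using card_Diff_subset[OF fU UV] card_mono[OF finite_V UV] by simp
  have 3: "int (\<Sum>v\<in>V. slack v) = (\<Sum>v\<in>V - U. int (slack v)) + int (\<Sum>v\<in>\<Union>Z. slack v)"
    using sum.subset_diff[OF UV finite_V, of slack] unfolding U_def[symmetric] by simp
  show ?thesis using 1 unfolding 2 3 rank1 c_def c'_def by (simp add: algebra_simps)
qed

text \<open>
  Blocks on at most three vertices span no more edges than they count, so their edges may as well be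
  counted as lying outside \<open>Z\<close>. This is where simplicity of the graph is needed.
\<close>

lemma small_block:
  assumes T: "T \<subseteq> E" "tight k T" and s: "card (\<Union>T) \<le> 3"
  shows "card {e\<in>E. e \<subseteq> \<Union>T} \<le> card T"
proof -
  have f: "finite (\<Union>T)" using T(1) by (rule finite_Union_edges)
  have "{e\<in>E. e \<subseteq> \<Union>T} \<subseteq> {e. e \<subseteq> \<Union>T \<and> card e = 2}" using card2 by auto
  then have "card {e\<in>E. e \<subseteq> \<Union>T} \<le> card {e. e \<subseteq> \<Union>T \<and> card e = 2}"
    using f by (intro card_mono) (auto intro: finite_subset[of _ "Pow (\<Union>T)"])
  also have "\<dots> = card (\<Union>T) choose 2" by (rule n_subsets[OF f])
  finally have 1: "card {e\<in>E. e \<subseteq> \<Union>T} \<le> card (\<Union>T) choose 2" .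
  obtain e where e: "e \<in> T" using T(2) unfolding tight_def by auto
  have "card e = 2" using e T(1) card2 by auto
  moreover have "card e \<le> card (\<Union>T)" using f e by (intro card_mono) auto
  ultimately have "card (\<Union>T) = 2 \<or> card (\<Union>T) = 3" using s by linarith
  moreover have "card T + 2 * k = k * card (\<Union>T) + 1" using T(2) unfolding tight_def by simp
  ultimately show ?thesis using 1 k by (auto simp: choose_two)
qed

text \<open>For \<open>p = 0\<close> the rigid blocks carry no weight. Otherwise \<open>Z'\<close>
  keeps only the edges of \<open>Z\<close> inside blocks on at least four vertices; the edges of
  \<open>Z - Z'\<close> now count in \<open>E - Z'\<close>, and the small blocks, counted
  \<open>p \<ge> 1\<close> times in the rank, pay for them.\<close>

lemma packing_count:
  assumes Z: "Z \<subseteq> E"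
  shows "int m * (int (card V) - 1) + int p * (int k * int (card V) - 2 * int k + 1) + int (\<Sum>v\<in>V. slack v)
       \<le> int (card (E - Z)) + int m * int (sparse_rank 1 Z) + int p * int (sparse_rank k Z)
         + int (\<Sum>v\<in>\<Union>Z. slack v)"
proof (cases "p = 0")
  case True
  then show ?thesis using block_count[OF Z, of "{}"] by simp
next
  case False
  obtain \<T> where fin\<T>: "finite \<T>" and \<T>: "\<And>T. T \<in> \<T> \<Longrightarrow> T \<subseteq> Z \<and> tight k T \<and> sparse k T"
    and cover: "\<And>e. e \<in> Z \<Longrightarrow> \<exists>T\<in>\<T>. e \<subseteq> \<Union>T"
    and \<T>sum: "(\<Sum>T\<in>\<T>. card T) = sparse_rank k Z"
  proof (rule sparse_rank_blocks[OF _ Z, of k])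
    fix \<T>
    assume *: "finite \<T>" "\<And>T. T \<in> \<T> \<Longrightarrow> T \<subseteq> Z \<and> tight k T \<and> sparse k T"
      "\<And>e. e \<in> Z \<Longrightarrow> \<exists>T\<in>\<T>. e \<subseteq> \<Union>T"
      "(\<Sum>T\<in>\<T>. card T) = sparse_rank k Z"
    show thesis by (rule that[OF *])
  qed (use k in simp)
  define \<B> where "\<B> = {T\<in>\<T>. card (\<Union>T) \<ge> 4}"
  define Z' where "Z' = {e\<in>Z. \<exists>T\<in>\<B>. e \<subseteq> \<Union>T}"
  have Z'Z: "Z' \<subseteq> Z" unfolding Z'_def by auto
  then have Z'E: "Z' \<subseteq> E" using Z by auto
  have fin\<B>: "finite \<B>" using fin\<T> unfolding \<B>_def by simp
  have cnt: "int m * (int (card V) - 1) + int p * (int k * int (card V) - 2 * int k + 1) + int (\<Sum>v\<in>V. slack v)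
       \<le> int (card (E - Z')) + int m * int (sparse_rank 1 Z') + int p * int (\<Sum>T\<in>\<B>. card T)
         + int (\<Sum>v\<in>\<Union>Z'. slack v)"
  proof (rule block_count[OF Z'E fin\<B>])
    show "T \<subseteq> Z' \<and> tight k T \<and> sparse k T \<and> card (\<Union>T) \<ge> 4" if "T \<in> \<B>" for T
    proof -
      have T: "T \<in> \<T>" "card (\<Union>T) \<ge> 4" using that unfolding \<B>_def by auto
      then show ?thesis using \<T>[OF T(1)] that unfolding Z'_def by blast
    qed
    show "p = 0 \<or> (\<forall>e\<in>Z'. \<exists>T\<in>\<B>. e \<subseteq> \<Union>T)" unfolding Z'_def by blast
  qed
  have "card (Z - Z') \<le> (\<Sum>T\<in>\<T> - \<B>. card T)"
  proof -
    have "Z - Z' \<subseteq> (\<Union>T\<in>\<T> - \<B>. {e\<in>E. e \<subseteq> \<Union>T})" 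
    proof
      fix e assume e: "e \<in> Z - Z'"
      then obtain T where T: "T \<in> \<T>" "e \<subseteq> \<Union>T" using cover[of e] by auto
      then have "T \<notin> \<B>" using e unfolding Z'_def by auto
      then show "e \<in> (\<Union>T\<in>\<T> - \<B>. {e\<in>E. e \<subseteq> \<Union>T})" using T e Z by auto
    qed
    then have "card (Z - Z') \<le> card (\<Union>T\<in>\<T> - \<B>. {e\<in>E. e \<subseteq> \<Union>T})"
      using fin\<T> finite_E by (intro card_mono) auto
    also have "\<dots> \<le> (\<Sum>T\<in>\<T> - \<B>. card {e\<in>E. e \<subseteq> \<Union>T})" using fin\<T> by (intro card_UN_le) auto
    also have "\<dots> \<le> (\<Sum>T\<in>\<T> - \<B>. card T)"
    proof (intro sum_mono small_block)
      fix T assume "T \<in> \<T> - \<B>"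
      then show "T \<subseteq> E" "tight k T" "card (\<Union>T) \<le> 3" using \<T>[of T] Z unfolding \<B>_def by auto
    qed
    finally show ?thesis .
  qed
  moreover have "\<B> \<subseteq> \<T>" unfolding \<B>_def by auto
  then have "(\<Sum>T\<in>\<T>. card T) = (\<Sum>T\<in>\<T> - \<B>. card T) + (\<Sum>T\<in>\<B>. card T)"
    using fin\<T> by (rule sum.subset_diff)
  ultimately have "card (Z - Z') + (\<Sum>T\<in>\<B>. card T) \<le> sparse_rank k Z" unfolding \<T>sum[symmetric] by linarith
  then have "int (card (Z - Z')) \<le> int (sparse_rank k Z) - int (\<Sum>T\<in>\<B>. card T)" by linarith
  then have "int p * int (card (Z - Z')) \<le> int p * (int (sparse_rank k Z) - int (\<Sum>T\<in>\<B>. card T))"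
    by (intro mult_left_mono) auto
  then have "int p * int (card (Z - Z')) \<le> int p * int (sparse_rank k Z) - int p * int (\<Sum>T\<in>\<B>. card T)"
    by (simp only: right_diff_distrib)
  moreover have "1 * int (card (Z - Z')) \<le> int p * int (card (Z - Z'))"
    using False by (intro mult_right_mono) auto
  moreover have "card (E - Z') \<le> card (E - Z) + card (Z - Z')"
  proof -
    have "E - Z' = (E - Z) \<union> (Z - Z')" using Z Z'Z by auto
    then show ?thesis by (simp add: card_Un_le)
  qed
  moreover have "int m * int (sparse_rank 1 Z') \<le> int m * int (sparse_rank 1 Z)"
    using sparse_rank_mono[OF Z'Z Z] by (intro mult_left_mono) auto
  moreover have "(\<Sum>v\<in>\<Union>Z'. slack v) \<le> (\<Sum>v\<in>\<Union>Z. slack v)"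
    using finite_Union_edges[OF Z] Z'Z by (intro sum_mono2) auto
  ultimately show ?thesis using cnt by linarith
qed

section \<open>The packing\<close>

text \<open>Lets the bound on discarded edges serve as a rank in \<open>rado_colouring\<close>.
  Equality can fail, since \<open>\<Union>J \<inter> \<Union>J'\<close> may be larger than
  \<open>\<Union>(J \<inter> J')\<close>.\<close>

lemma slack_sum_submodular:
  assumes "J \<subseteq> E" "J' \<subseteq> E"
  shows "(\<Sum>v\<in>\<Union>(J \<union> J'). slack v) + (\<Sum>v\<in>\<Union>(J \<inter> J'). slack v)
      \<le> (\<Sum>v\<in>\<Union>J. slack v) + (\<Sum>v\<in>\<Union>J'. slack v)"
proof -
  note f = finite_Union_edges[OF assms(1)] finite_Union_edges[OF assms(2)]
  have "(\<Sum>v\<in>\<Union>(J \<inter> J'). slack v) \<le> (\<Sum>v\<in>\<Union>J \<inter> \<Union>J'. slack v)"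
    using f by (intro sum_mono2) auto
  moreover have "(\<Sum>v\<in>\<Union>J \<union> \<Union>J'. slack v) + (\<Sum>v\<in>\<Union>J \<inter> \<Union>J'. slack v)
      = (\<Sum>v\<in>\<Union>J. slack v) + (\<Sum>v\<in>\<Union>J'. slack v)"
    by (rule sum.union_inter[OF f])
  ultimately show ?thesis by (simp add: Union_Un_distrib)
qed

text \<open>The edges of \<open>K\<close> missing \<open>v\<close> live on \<open>V - {v}\<close>
  and number at most the slack there; the rest of the total must sit at \<open>v\<close>.\<close>

lemma degree_ge_slack:
  assumes K: "K \<subseteq> E" "\<And>J. J \<subseteq> K \<Longrightarrow> card J \<le> (\<Sum>v\<in>\<Union>J. slack v)"
    and c: "card K = (\<Sum>v\<in>V. slack v)" and v: "v \<in> V"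
  shows "slack v \<le> degree K v"
proof -
  let ?J = "{e\<in>K. v \<notin> e}"
  have fK: "finite K" using K(1) by (rule finite_edges)
  have "\<Union>?J \<subseteq> V - {v}" using K(1) edge_subset by blast
  then have "(\<Sum>v\<in>\<Union>?J. slack v) \<le> (\<Sum>v\<in>V - {v}. slack v)"
    using finite_V by (intro sum_mono2) auto
  moreover have "card ?J \<le> (\<Sum>v\<in>\<Union>?J. slack v)" by (rule K(2)) auto
  moreover have "card K = card {e\<in>K. v \<in> e} + card ?J"
    using fK by (subst card_Un_disjoint[symmetric]) (auto intro!: arg_cong[of _ _ card])
  moreover have "(\<Sum>v\<in>V. slack v) = slack v + (\<Sum>v\<in>V - {v}. slack v)"
    by (rule sum.remove[OF finite_V v])
  ultimately show ?thesis using c unfolding degree_def by linarith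
qed

lemma sparse_card_le:
  assumes "sparse \<kappa> I" "I \<subseteq> E"
  shows "card I + 2 * \<kappa> \<le> \<kappa> * card V + 1"
proof (cases "I = {}")
  case True
  have "\<kappa> * 2 \<le> \<kappa> * card V" using two by (intro mult_le_mono2)
  then show ?thesis unfolding True card.empty by linarith
next
  case False
  have "card (\<Union>I) \<le> card V" using edge_subset assms(2) finite_V by (intro card_mono) auto
  then have "\<kappa> * card (\<Union>I) \<le> \<kappa> * card V" by simp
  then show ?thesis using sparseD[OF assms(1) order_refl False] by linarith
qed

lemma packing_exists:
  "\<exists>H\<subseteq>E. contains_packing m p k V H \<and>
      (\<forall>v\<in>V. degree H v + slack v \<le> degree E v)"
proof -
  define N where "N = m * (card V - 1) + p * (k * card V + 1 - 2 * k) + (\<Sum>v\<in>V. slack v)"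
  \<comment> \<open>The first \<open>m\<close> colours are for the trees, the next \<open>p\<close>
    for the rigid graphs, \<open>m + p\<close> for the discarded edges and the last one for leftover
    edges. \<open>N\<close> is the number of edges wanted in the other classes; capping the last
    class at \<open>card E - N\<close> forces them to be full.\<close>
  define r where "r i J = (if i < m then sparse_rank 1 J else if i < m + p then sparse_rank k J
     else if i = m + p then (\<Sum>v\<in>\<Union>J. slack v) else min (card J) (card E - N))" for i :: nat and J
  have k1: "k \<ge> 1" using k by simp
  have kV: "2 * k \<le> k * card V" using two by (simp add: mult.commute)
  have intN: "int N = int m * (int (card V) - 1) + int p * (int k * int (card V) - 2 * int k + 1)
     + int (\<Sum>v\<in>V. slack v)"
  proof -
    have "int (card V - 1) = int (card V) - 1" using two by simp
    moreover have "int (k * card V + 1 - 2 * k) = int k * int (card V) - 2 * int k + 1"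
    proof -
      have "int (k * card V + 1 - 2 * k) = int (k * card V + 1) - int (2 * k)"
        using kV by (intro of_nat_diff) linarith
      then show ?thesis by simp
    qed
    ultimately show ?thesis unfolding N_def by (simp only: of_nat_add of_nat_mult)
  qed
  have rank_empty: "sparse_rank \<kappa> {} = 0" for \<kappa>
  proof -
    have *: "{I. I \<subseteq> {} \<and> sparse \<kappa> I} = {{}}" using sparse_empty by auto
    show ?thesis unfolding sparse_rank_def * by simp
  qed
  have count: "N \<le> card (E - Z) + m * sparse_rank 1 Z + p * sparse_rank k Z + (\<Sum>v\<in>\<Union>Z. slack v)"
    if "Z \<subseteq> E" for Z
  proof -
    have "int N \<le> int (card (E - Z) + m * sparse_rank 1 Z + p * sparse_rank k Z + (\<Sum>v\<in>\<Union>Z. slack v))"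
      using packing_count[OF that] unfolding intN[symmetric] by (simp only: of_nat_add of_nat_mult)
    then show ?thesis by (simp only: of_nat_le_iff)
  qed
  have NE: "N \<le> card E" using count[of "{}"] by (simp add: rank_empty)
  have split: "(\<Sum>i<m + p + 2. h i) = (\<Sum>i<m. h i) + (\<Sum>i<p. h (m + i)) + h (m + p) + h (m + p + 1)"
    for h :: "nat \<Rightarrow> nat"
  proof -
    have "(\<Sum>i<m + p. h i) = (\<Sum>i<m. h i) + (\<Sum>i<p. h (m + i))"
      by (induction p) (auto simp: add.assoc)
    then show ?thesis by (simp add: numeral_2_eq_2)
  qed
  have "\<exists>col. (\<forall>e\<in>E. col e \<in> {..<m + p + 2}) \<and>
      (\<forall>i\<in>{..<m + p + 2}. \<forall>J\<subseteq>{e\<in>E. col e = i}. card J \<le> r i J)"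
  proof (rule rado_colouring[OF finite_E])
    show "r i J \<le> r i J'" if J: "J \<subseteq> J'" "J' \<subseteq> E" for i J J'
    proof -
      have "card J \<le> card J'" using J finite_edges by (intro card_mono) auto
      moreover have "(\<Sum>v\<in>\<Union>J. slack v) \<le> (\<Sum>v\<in>\<Union>J'. slack v)"
        using J finite_Union_edges[OF J(2)] by (intro sum_mono2) auto
      ultimately show ?thesis using sparse_rank_mono[OF J] unfolding r_def by auto
    qed
    show "r i (J \<union> J') + r i (J \<inter> J') \<le> r i J + r i J'" if J: "J \<subseteq> E" "J' \<subseteq> E" for i J J'
    proof -
      have f: "finite J" "finite J'" using J finite_edges by auto
      have "card (J \<union> J') + card (J \<inter> J') = card J + card J'" using card_Un_Int[OF f] by simp
      moreover have "card (J \<inter> J') \<le> card J" "card (J \<inter> J') \<le> card J'" using f by (auto intro: card_mono)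
      ultimately have "min (card (J \<union> J')) q + min (card (J \<inter> J')) q \<le> min (card J) q + min (card J') q" for q
        by linarith
      then show ?thesis
        using sparse_rank_submodular[OF order_refl J] sparse_rank_submodular[OF k1 J] slack_sum_submodular[OF J]
        unfolding r_def by simp
    qed
    show "r i {} = 0" for i unfolding r_def by (simp add: rank_empty)
    show "card J \<le> (\<Sum>i\<in>{..<m + p + 2}. r i J)" if J: "J \<subseteq> E" for J
    proof -
      have "(\<Sum>i<m. r i J) = m * sparse_rank 1 J" by (simp add: r_def)
      moreover have "(\<Sum>i<p. r (m + i) J) = p * sparse_rank k J" by (simp add: r_def)
      ultimately have "(\<Sum>i<m + p + 2. r i J) = m * sparse_rank 1 J + p * sparse_rank k J + (\<Sum>v\<in>\<Union>J. slack v)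
          + min (card J) (card E - N)"
        unfolding split by (simp add: r_def)
      moreover have "card (E - J) + card J = card E"
        using card_Diff_subset[OF finite_edges[OF J] J] card_mono[OF finite_E J] by simp
      \<comment> \<open>If the cap is inactive, the last summand alone is \<open>card J\<close>;
        otherwise the claim is the rank inequality for \<open>Z = J\<close>.\<close>
      ultimately show ?thesis using count[OF J] NE by linarith
    qed
  qed simp
  then obtain col where col: "\<forall>e\<in>E. col e \<in> {..<m + p + 2}"
    and ind: "\<forall>i\<in>{..<m + p + 2}. \<forall>J\<subseteq>{e\<in>E. col e = i}. card J \<le> r i J"
    by (elim exE conjE)
  define I where "I i = {e\<in>E. col e = i}" for i
  have IE: "I i \<subseteq> E" for i unfolding I_def by auto
  have disj: "I i \<inter> I j = {}" if "i \<noteq> j" for i j using that unfolding I_def by auto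
  have indI: "card J \<le> r i J" if "i < m + p + 2" "J \<subseteq> I i" for i J
    using ind[rule_format, of i J] that unfolding I_def by simp
  have sp1: "sparse 1 (I i)" if "i < m" for i
    using indI[of i "I i"] that IE[of i] by (intro sparse_if_card_le_rank) (auto simp: r_def)
  have spk: "sparse k (I (m + i))" if "i < p" for i
    using indI[of "m + i" "I (m + i)"] that IE[of "m + i"] by (intro sparse_if_card_le_rank) (auto simp: r_def)
  have b1: "card (I i) \<le> card V - 1" if "i < m" for i
    using sparse_card_le[OF sp1[OF that] IE] two by simp
  have bk: "card (I (m + i)) \<le> k * card V + 1 - 2 * k" if "i < p" for i
    using sparse_card_le[OF spk[OF that] IE] by simp
  have bK: "card (I (m + p)) \<le> (\<Sum>v\<in>V. slack v)"
  proof -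
    have "card (I (m + p)) \<le> (\<Sum>v\<in>\<Union>(I (m + p)). slack v)"
      using indI[of "m + p" "I (m + p)"] by (simp add: r_def)
    also have "\<dots> \<le> (\<Sum>v\<in>V. slack v)"
    proof (rule sum_mono2[OF finite_V])
      show "\<Union>(I (m + p)) \<subseteq> V" using edge_subset IE[of "m + p"] by blast
    qed simp
    finally show ?thesis .
  qed
  have bD: "card (I (m + p + 1)) \<le> card E - N"
    using indI[of "m + p + 1" "I (m + p + 1)"] by (simp add: r_def)
  have total: "(\<Sum>i<m. card (I i)) + (\<Sum>i<p. card (I (m + i))) + card (I (m + p)) + card (I (m + p + 1)) = card E"
  proof -
    have "card E = card (\<Union>i\<in>{..<m + p + 2}. I i)"
      using col unfolding I_def by (intro arg_cong[of _ _ card]) auto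
    also have "\<dots> = (\<Sum>i<m + p + 2. card (I i))"
      using IE finite_edges disj by (intro card_UN_disjoint) auto
    finally show ?thesis unfolding split by simp
  qed
  have s1: "(\<Sum>i<m. card (I i)) \<le> m * (card V - 1)"
    using sum_bounded_above[of "{..<m}" "\<lambda>i. card (I i)"] b1 by simp
  have sk: "(\<Sum>i<p. card (I (m + i))) \<le> p * (k * card V + 1 - 2 * k)"
    using sum_bounded_above[of "{..<p}" "\<lambda>i. card (I (m + i))"] bk by simp
  \<comment> \<open>The upper bounds of the four groups of classes add up to
    \<open>N + (card E - N) = card E\<close>, so none of them is strict.\<close>
  have e1: "(\<Sum>i<m. card (I i)) = m * (card V - 1)" and ek: "(\<Sum>i<p. card (I (m + i))) = p * (k * card V + 1 - 2 * k)"
    and eK: "card (I (m + p)) = (\<Sum>v\<in>V. slack v)"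
    using s1 sk bK bD total NE unfolding N_def by linarith+
  have all_eq: "h i = b" if "(\<Sum>i<q. h i) = q * b" "\<And>i. i < q \<Longrightarrow> h i \<le> b" "i < q"
    for h :: "nat \<Rightarrow> nat" and q b i
  proof (rule ccontr)
    assume "h i \<noteq> b"
    then have "(\<Sum>i<q. h i) < (\<Sum>i<q. b)" using that(2,3)
      by (intro sum_strict_mono_ex1) (auto intro!: bexI[of _ i] le_neq_implies_less)
    with that(1) show False by simp
  qed
  have gr: "e \<subseteq> V \<and> card e = 2" if "e \<in> I i" for e i
    using that IE edge_subset card2 by blast
  have Vne: "V \<noteq> {}" using two by auto
  have tree: "is_tree V (I i)" if "i < m" for i
  proof (rule tree_if_sparse[OF finite_V Vne gr sp1[OF that]])
    have "card (I i) = card V - 1" using all_eq[OF e1 b1 that] by simp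
    then show "card (I i) + 1 = card V" using two by simp
  qed
  have rigid: "k_rigid k V (I (m + i))" if "i < p" for i
  proof (rule k_rigid_if_sparse[OF finite_V two gr k1 spk[OF that]])
    have "card (I (m + i)) = k * card V + 1 - 2 * k" using all_eq[OF ek bk that] by simp
    then show "card (I (m + i)) + 2 * k = k * card V + 1" using kV by linarith
  qed
  have sub: "I i \<subseteq> E - I (m + p)" if "i < m + p" for i
    using IE[of i] disj[of i "m + p"] that by blast
  have "contains_packing m p k V (E - I (m + p))" unfolding contains_packing_def
  proof (intro exI conjI)
    show "\<forall>i<m. I i \<subseteq> E - I (m + p) \<and> is_tree V (I i)" using sub tree by simp
    show "\<forall>j<p. I (m + j) \<subseteq> E - I (m + p) \<and> k_rigid k V (I (m + j))" using sub rigid by simp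
    show "\<forall>i<m. \<forall>i'<m. i \<noteq> i' \<longrightarrow> I i \<inter> I i' = {}" using disj by simp
    show "\<forall>j<p. \<forall>j'<p. j \<noteq> j' \<longrightarrow> I (m + j) \<inter> I (m + j') = {}" using disj by simp
    show "\<forall>i<m. \<forall>j<p. I i \<inter> I (m + j) = {}" using disj by simp
  qed
  moreover have "degree (E - I (m + p)) v + slack v \<le> degree E v" if v: "v \<in> V" for v
  proof -
    have "slack v \<le> degree (I (m + p)) v"
      using indI[of "m + p"] by (intro degree_ge_slack[OF IE _ eK v]) (auto simp: r_def)
    moreover have "degree E v = degree (E - I (m + p)) v + degree (I (m + p)) v"
      unfolding degree_def using finite_E IE[of "m + p"]
      by (subst card_Un_disjoint[symmetric]) (auto intro!: arg_cong[of _ _ card] intro: finite_subset)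
    ultimately show ?thesis by simp
  qed
  ultimately show ?thesis by blast
qed

end

text \<open>The counting above assumes two vertices. On one vertex the empty edge set is both a tree
  and k-rigid, and it is disjoint from itself.\<close>

lemma packing_one_vertex:
  assumes "card V = 1"
  shows "contains_packing m p k V {}"
proof -
  obtain v where V: "V = {v}" using assms card_1_singletonE by blast
  have "is_tree V {}"
    unfolding is_tree_def simple_graph_def connected_graph_def is_cycle_def V
    by (auto intro!: exI[of _ 0])
  moreover have "k_rigid k V {}"
  proof -
    have "card X = 1" if "X \<subseteq> V" "X \<noteq> {}" for X
      using that subset_singletonD unfolding V by fastforce
    then show ?thesis
      unfolding k_rigid_def simple_graph_def ell_def induced_edge_count_def using V by auto
  qed
  ultimately show ?thesis unfolding contains_packing_def by (intro exI[of _ "\<lambda>_. {}"]) auto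
qed

section \<open>The degree bound from the discarded edges\<close>

theorem theorem10p1:
  fixes V :: "'a set" and E :: "'a set set" and k p m :: nat
  assumes "k \<ge> 2"
    and "simple_graph V E"
    and "weakly_connected k (4 * int k * int p - 2 * int p + 2 * int m) V E"
  shows "\<exists>H\<subseteq>E. contains_packing m p k V H \<and>
           (\<forall>v\<in>V. int (degree H v) \<le> \<lceil>real (degree E v) / 2\<rceil> + int k * int p + int m)"
proof (cases "card V \<ge> 2")
  case True
  interpret weakly_connected_graph V E k p m by unfold_locales (use assms True in auto)
  obtain H where H: "H \<subseteq> E" "contains_packing m p k V H"
    and deg: "\<And>v. v \<in> V \<Longrightarrow> degree H v + slack v \<le> degree E v"
    using packing_exists by blast
  have "int (degree H v) \<le> \<lceil>real (degree E v) / 2\<rceil> + int k * int p + int m" if "v \<in> V" for v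
  proof -
    have "2 * degree H v \<le> degree E v + 1 + 2 * (k * p + m)"
    proof -
      \<comment> \<open>The summand 1 accounts for odd \<open>d\<close>. The bound also holds when
        \<open>d div 2 - x\<close> truncates to 0, as then \<open>d \<le> 2 * x + 1\<close>.\<close>
      have "2 * h \<le> d + 1 + 2 * x" if "h + (d div 2 - x) \<le> d" for h d x :: nat
        using that by presburger
      then show ?thesis using deg[OF that] unfolding slack_def by blast
    qed
    then have "real (2 * degree H v) \<le> real (degree E v + 1 + 2 * (k * p + m))"
      by (simp only: of_nat_le_iff)
    \<comment> \<open>An integer is at most the ceiling of a real number iff the integer minus 1 is
      strictly below that number.\<close>
    then have "real (degree H v) - real (k * p + m) - 1 < real (degree E v) / 2" by simp
    then have "int (degree H v) - int (k * p + m) \<le> \<lceil>real (degree E v) / 2\<rceil>"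
      by (simp add: le_ceiling_iff)
    then show ?thesis by simp
  qed
  with H show ?thesis by blast
next
  case False
  have V: "finite V" "V \<noteq> {}" using assms(2) unfolding simple_graph_def by auto
  then have "card V = 1" using False by (simp add: card_gt_0_iff flip: Suc_le_eq)
      (metis One_nat_def Suc_1 card_0_eq less_2_cases not_less)
  then have "contains_packing m p k V {}" by (rule packing_one_vertex)
  moreover have "degree {} v = 0" for v :: 'a unfolding degree_def by simp
  ultimately show ?thesis by (intro exI[of _ "{}"]) auto
qed

end
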